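(* The branch and bound algorithm described in the context (Steps 0–5) terminates in a finite number of iterations and returns an optimal solution of $(PE)$: $\max\{\psi(x)\mid x\in XE\}$.
   Context: Problem. Let $X=\{x\in\mathbb{R}^n\mid Ax=b,\ x\ge 0\}$ be a non-empty compact polyhedron, where $A$ is an $m\times n$ matrix and $b\in\mathbb{R}^m$, and let $D=X\cap\mathbb{Z}^n$. For $i=1,\dots,k$ let $z_i(x)=\frac{p_i^t x+\alpha_i}{q_i^t x+\beta_i}$ with $p_i,q_i\in\mathbb{R}^n$, $\alpha_i,\beta_i\in\mathbb{R}$ and $q_i^t x+\beta_i>0$ for all $x\in X$; put $z=(z_1,\dots,z_k)$. Problem $(P)$ is the simultaneous maximization of $z_1,\dots,z_k$ over $D$. A vector $u\in\mathbb{R}^k$ dominates $v\in\mathbb{R}^k$ if $u_i\ge v_i$ for all $i$ and $u_i>v_i$ for some $i$. A point $x\in D$ is efficient for $(P)$ if no $y\in D$ has $z(y)$ dominating $z(x)$; $XE$ is the set of efficient points. Let $\psi(x)=\frac{c^t x+\lambda}{d^t x+\mu}$ with $c,d\in\mathbb{R}^n$, $\lambda,\mu\in\mathbb{R}$ and $d^tx+\mu>0$ on $X$. Problem $(PE)$ is $\max\{\psi(x)\mid x\in XE\}$. Notation at stage (node) $l$. $X_0=X$; $X_l\subseteq X$ is the current polyhedron, obtained from $X$ by adding the branching constraints and cuts accumulated so far, written in standard form with nonnegative slack variables for the added constraints (variable indices range over original and slack variables). $(PE^l)$ is $\max\{\psi(x)\mid x\in X_l\}$. $\psi_{opt}$ and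 $x_{opt}$ are the value and the best efficient solution found so far. $XE_l$ is the current set of potentially efficient solutions of $(P)$: it consists of integer solutions found so far that are not dominated (in criterion vector) by other found ones. At an integer optimal basic solution $x^*_l$ of $(PE^l)$ with nonbasic index set $N_l$, write $p_i^tx+\alpha_i=\sum_{j\in N_l}\bar p_{ij}x_j+\bar\alpha_i$, $q_i^tx+\beta_i=\sum_{j\in N_l}\bar q_{ij}x_j+\bar\beta_i$ (updated simplex tableau), $\bar\gamma_{ij}=\bar\beta_i\bar p_{ij}-\bar\alpha_i\bar q_{ij}$, and $$\Delta_l=\{j\in N_l\mid\exists i,\ \bar\gamma_{ij}>0\}\cup\{j\in N_l\mid\bar\gamma_{ij}=0\ \forall i\}.$$ Cut of type I: $\sum_{j\in\Delta_l}x_j\ge1$, with $X^1_{l+1}=\{x\in X_l\mid\sum_{j\in\Delta_l}x_j\ge1\}$. Cut of type II: $\psi(x)\ge\psi_{opt}$, with $X^2_{l+1}=\{x\in X_l\mid\psi(x)\ge\psi_{opt}\}$. The set resulting from both is $X_{l+1}=X^1_{l+1}\cap X^2_{l+1}$. The ideal point is $id^l=(id_1,\dots,id_k)$ with $id_i=\max\{z_i(x)\mid x\in X_l\}$. The efficiency program $(Q)$ for $x^*_l$ is $\max\{e^ts\mid z(x)-s=z(x^*_l),\ x\in D,\ s\ge0\}$, with $e$ the all-ones vector; it is known that $x^*_l$ is efficient iff the maximum is $0$, and otherwise the solution $x$ obtained is efficient. Algorithm. Step 0. Maximize $\psi(x)$ over $x\in X$ to optimality and test the resulting solution for efficiency.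 If it is efficient, stop (it is returned); else go to Step 1. Step 1 (initialization). $l=0$, $\psi_{opt}=-\infty$, $x_{opt}$ unknown, $XE_0=\emptyset$. Step 2 (main step). While there is a non-saturated (non-fathomed) node in the search tree, solve $(PE^l)$ using the dual simplex method (for $(PE^0)$ use the Cambini–Martein convex-simplex method for linear fractional programs), nodes being treated depth first. Go to Step 3.1. When all nodes are saturated the algorithm ends and returns $x_{opt},\psi_{opt}$. Step 3.1 (feasibility test). If $(PE^l)$ is infeasible, node $l$ is saturated. Else let $x^*_l$ be the obtained optimal solution; if $\psi_{opt}\ge\psi(x^*_l)$, node $l$ is fathomed; else go to Step 3.2. Step 3.2 (integrity test). If $x^*_l$ is integer, update $XE_l$ by introducing $x^*_l$ and go to Step 3.3; else go to Step 4. Step 3.3 (efficiency test). If $x^*_l$ is not kept within $XE_l$ (its criterion vector is dominated by that of an element of $XE_l$), it is not efficient; go to Step 5. Else solve $(Q)$. If $x^*_l$ is efficient, update if necessary $\psi_{opt}=\psi(x^*_l)$, $x_{opt}=x^*_l$, and node $l$ is pruned. Else let $y_l$ be the optimal solution of $(Q)$; update with $y_l$, if necessary, $\psi_{opt}$, $x_{opt}$, and the set $XE_l$; go to Step 5. Step 4 (branching). Choose a coordinate $x_j$ of $x^*_l$ with fractional value $a_j$. Split $(PE^l)$ into two subprograms by adding $x_j\le\lfloor a_j\rfloor$, giving $(PE^{l_1})$, and $x_j\ge\lfloor a_j\rfloor+1$, giving $(PE^{l_2})$, with new distinct node indices $l_1,l_2>l+1$; since the search is depth first, the cut of type II $\psi(x)\ge\psi_{opt}$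 is added in the second branch $l_2$. Go to Step 2. Step 5 (efficient cut). Construct $\Delta_l$ and compute $id^l$. If $\Delta_l=\emptyset$ or $id^l$ is dominated by the criterion vector of an element of $XE_l$, node $l$ is fathomed. Otherwise construct $X^1_{l+1}$ by adding the cut of type I, and go to Step 2. *)

theory Defs
  imports "HOL-Analysis.Analysis"
begin

text \<open>\<open>al\<close>, \<open>be\<close>, \<open>la\<close>, \<open>mu\<close> stand for $\alpha$, $\beta$, $\lambda$, $\mu$.\<close>

record ('n, 'm, 'k) problem =
  mat_A    :: "real ^ 'n::finite ^ 'm::finite"
  vec_b    :: "real ^ 'm::finite"
  vec_p    :: "real ^ 'n::finite ^ 'k::finite"
  coef_al  :: "real ^ 'k::finite"
  vec_q    :: "real ^ 'n::finite ^ 'k::finite"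
  coef_be  :: "real ^ 'k::finite"
  vec_c    :: "real ^ 'n::finite"
  coef_la  :: real
  vec_d    :: "real ^ 'n::finite"
  coef_mu  :: real

definition feas :: "('n::finite, 'm::finite, 'k::finite) problem \<Rightarrow> (real ^ 'n) set" where
  "feas P = {x. mat_A P *v x = vec_b P \<and> (\<forall>j. x $ j \<ge> 0)}"

definition integral_point :: "real ^ 'n::finite \<Rightarrow> bool" where
  "integral_point x \<longleftrightarrow> (\<forall>j. x $ j \<in> \<int>)"

definition int_feas :: "('n::finite, 'm::finite, 'k::finite) problem \<Rightarrow> (real ^ 'n) set" where
  "int_feas P = {x \<in> feas P. integral_point x}"

definition crit :: "('n::finite, 'm::finite, 'k::finite) problem \<Rightarrow> real ^ 'n \<Rightarrow> real ^ 'k" where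
  "crit P x = (\<chi> i. (vec_p P $ i \<bullet> x + coef_al P $ i) / (vec_q P $ i \<bullet> x + coef_be P $ i))"

definition psi :: "('n::finite, 'm::finite, 'k::finite) problem \<Rightarrow> real ^ 'n \<Rightarrow> real" where
  "psi P x = (vec_c P \<bullet> x + coef_la P) / (vec_d P \<bullet> x + coef_mu P)"

definition dominates :: "real ^ 'k::finite \<Rightarrow> real ^ 'k \<Rightarrow> bool" where
  "dominates u v \<longleftrightarrow> (\<forall>i. u $ i \<ge> v $ i) \<and> (\<exists>i. u $ i > v $ i)"

definition efficient_set :: "('n::finite, 'm::finite, 'k::finite) problem \<Rightarrow> (real ^ 'n) set" where
  "efficient_set P = {x \<in> int_feas P. \<not> (\<exists>y \<in> int_feas P. dominates (crit P y) (crit P x))}"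

text \<open>An added constraint \<open>(a, h)\<close> stands for \<open>a \<bullet> x \<ge> h\<close>.  In the standard form its row is
  \<open>a \<bullet> x - s = h\<close> with slack variable \<open>s \<ge> 0\<close>.  A node is described by the list of its added
  constraints; its variables are \<open>Inl j\<close>, the original variable \<open>j\<close>, and \<open>Inr r\<close>, the slack
  variable of the \<open>r\<close>-th added constraint.  Slack variables occurring in a later constraint are
  eliminated from it, so that every constraint is stated in the original variables.\<close>

type_synonym 'n constr = "(real ^ 'n) \<times> real"

definition node_set ::
  "('n::finite, 'm::finite, 'k::finite) problem \<Rightarrow> 'n constr list \<Rightarrow> (real ^ 'n) set" where
  "node_set P cs = {x \<in> feas P. \<forall>(a, h) \<in> set cs. a \<bullet> x \<ge> h}"

definition std_vars :: "'n::finite constr list \<Rightarrow> ('n + nat) set" where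
  "std_vars cs = range Inl \<union> Inr ` {..<length cs}"

text \<open>Variable \<open>v\<close> as an affine function of the original variables: if \<open>var_fun cs v = (a, h)\<close>
  then its value at \<open>x\<close> is \<open>a \<bullet> x - h\<close>.\<close>

definition var_fun :: "'n::finite constr list \<Rightarrow> 'n + nat \<Rightarrow> 'n constr" where
  "var_fun cs v = (case v of Inl j \<Rightarrow> (axis j 1, 0) | Inr r \<Rightarrow> cs ! r)"

definition var_val :: "'n::finite constr list \<Rightarrow> real ^ 'n \<Rightarrow> 'n + nat \<Rightarrow> real" where
  "var_val cs x v = fst (var_fun cs v) \<bullet> x - snd (var_fun cs v)"

text \<open>Columns of the standard-form matrix.  Row \<open>Inl i\<close> is the \<open>i\<close>-th row of the original system,
  row \<open>Inr r\<close> is the row of the \<open>r\<close>-th added constraint; all further rows are zero.\<close>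

definition std_col ::
  "('n::finite, 'm::finite, 'k::finite) problem \<Rightarrow> 'n constr list \<Rightarrow> 'n + nat \<Rightarrow> 'm + nat \<Rightarrow> real" where
  "std_col P cs v \<rho> =
     (case (\<rho>, v) of
        (Inl i, Inl j) \<Rightarrow> mat_A P $ i $ j
      | (Inl i, Inr s) \<Rightarrow> 0
      | (Inr r, Inl j) \<Rightarrow> (if r < length cs then fst (cs ! r) $ j else 0)
      | (Inr r, Inr s) \<Rightarrow> (if r < length cs \<and> s = r then -1 else 0))"

lemma std_form_original_row:
  "(\<Sum>v\<in>std_vars cs. std_col P cs v (Inl i) * var_val cs x v) = (mat_A P *v x) $ i"
  unfolding std_vars_def
  by (subst sum.union_disjoint)
    (auto simp: sum.reindex inj_on_def std_col_def var_val_def var_fun_def inner_axis'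
      matrix_vector_mult_def)

lemma std_form_added_row:
  assumes "r < length cs"
  shows "(\<Sum>v\<in>std_vars cs. std_col P cs v (Inr r) * var_val cs x v) = snd (cs ! r)"
  using assms unfolding std_vars_def
  by (subst sum.union_disjoint)
    (auto simp: sum.reindex inj_on_def std_col_def var_val_def var_fun_def inner_axis'
      inner_vec_def[of "fst (cs ! r)"] if_distrib[where f = "\<lambda>u. u * _"] sum.If_cases cong: if_cong)

text \<open>The columns indexed by \<open>B\<close> form a basis of the column space: they are linearly independent
  and every other column is a linear combination of them.  No full row rank is presupposed.\<close>

definition is_basis ::
  "('n::finite, 'm::finite, 'k::finite) problem \<Rightarrow> 'n constr list \<Rightarrow> ('n + nat) set \<Rightarrow> bool" where
  "is_basis P cs B \<longleftrightarrow>
     B \<subseteq> std_vars cs \<and>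
     (\<forall>w. (\<forall>\<rho>. (\<Sum>v\<in>B. w v * std_col P cs v \<rho>) = 0) \<longrightarrow> (\<forall>v\<in>B. w v = 0)) \<and>
     (\<forall>j\<in>std_vars cs. \<exists>w. \<forall>\<rho>. std_col P cs j \<rho> = (\<Sum>v\<in>B. w v * std_col P cs v \<rho>))"

definition optimal_basic ::
  "('n::finite, 'm::finite, 'k::finite) problem \<Rightarrow> 'n constr list \<Rightarrow> real ^ 'n \<Rightarrow> ('n + nat) set \<Rightarrow> bool" where
  "optimal_basic P cs x N \<longleftrightarrow>
     N \<subseteq> std_vars cs \<and> is_basis P cs (std_vars cs - N) \<and> (\<forall>j\<in>N. var_val cs x j = 0) \<and>
     is_arg_max (psi P) (\<lambda>x. x \<in> node_set P cs) x"

text \<open>Updated tableau form of the affine function \<open>a \<bullet> x + a0\<close>.  The identity is required on all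
  solutions of the equality system, regardless of signs; for a basis this makes the coefficients
  on \<open>N\<close> and the constant unique.\<close>

definition reduced_form ::
  "('n::finite, 'm::finite, 'k::finite) problem \<Rightarrow> 'n constr list \<Rightarrow> ('n + nat) set
    \<Rightarrow> real ^ 'n \<Rightarrow> real \<Rightarrow> ('n + nat \<Rightarrow> real) \<Rightarrow> real \<Rightarrow> bool" where
  "reduced_form P cs N a a0 ab a0b \<longleftrightarrow>
     (\<forall>x. mat_A P *v x = vec_b P \<longrightarrow> a \<bullet> x + a0 = (\<Sum>j\<in>N. ab j * var_val cs x j) + a0b)"

definition is_Delta ::
  "('n::finite, 'm::finite, 'k::finite) problem \<Rightarrow> 'n constr list \<Rightarrow> ('n + nat) set
    \<Rightarrow> ('n + nat) set \<Rightarrow> bool" where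
  "is_Delta P cs N \<Delta> \<longleftrightarrow>
     (\<exists>pb alb qb beb \<gamma>.
        (\<forall>i. reduced_form P cs N (vec_p P $ i) (coef_al P $ i) (pb i) (alb i)) \<and>
        (\<forall>i. reduced_form P cs N (vec_q P $ i) (coef_be P $ i) (qb i) (beb i)) \<and>
        (\<forall>i j. \<gamma> i j = beb i * pb i j - alb i * qb i j) \<and>
        \<Delta> = {j \<in> N. \<exists>i::'k. \<gamma> i j > 0} \<union> {j \<in> N. \<forall>i::'k. \<gamma> i j = 0})"

definition cut_I :: "'n::finite constr list \<Rightarrow> ('n + nat) set \<Rightarrow> 'n constr" where
  "cut_I cs \<Delta> = ((\<Sum>j\<in>\<Delta>. fst (var_fun cs j)), 1 + (\<Sum>j\<in>\<Delta>. snd (var_fun cs j)))"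

definition cut_II :: "('n::finite, 'm::finite, 'k::finite) problem \<Rightarrow> real \<Rightarrow> 'n constr" where
  "cut_II P t = (vec_c P - t *\<^sub>R vec_d P, t * coef_mu P - coef_la P)"

lemma node_set_cut_I:
  "node_set P (cs @ [cut_I cs \<Delta>]) = {x \<in> node_set P cs. (\<Sum>j\<in>\<Delta>. var_val cs x j) \<ge> 1}"
  by (auto simp: node_set_def cut_I_def var_val_def sum_subtractf inner_sum_left)

lemma node_set_cut_II:
  assumes "\<And>x. x \<in> feas P \<Longrightarrow> vec_d P \<bullet> x + coef_mu P > 0"
  shows "node_set P (cs @ [cut_II P t]) = {x \<in> node_set P cs. psi P x \<ge> t}"
proof -
  have "(vec_c P - t *\<^sub>R vec_d P) \<bullet> x \<ge> t * coef_mu P - coef_la P \<longleftrightarrow> psi P x \<ge> t"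
    if "x \<in> feas P" for x
    using assms[OF that] by (simp add: psi_def pos_le_divide_eq inner_diff_left algebra_simps)
  then show ?thesis
    by (auto simp: node_set_def cut_II_def)
qed

text \<open>On the nonempty compact node sets to which this is applied, the supremum is a maximum.\<close>

definition ideal_point ::
  "('n::finite, 'm::finite, 'k::finite) problem \<Rightarrow> (real ^ 'n) set \<Rightarrow> real ^ 'k" where
  "ideal_point P S = (\<chi> i. SUP x\<in>S. crit P x $ i)"

definition eff_prog_solution ::
  "('n::finite, 'm::finite, 'k::finite) problem \<Rightarrow> real ^ 'n \<Rightarrow> (real ^ 'n) \<times> (real ^ 'k) \<Rightarrow> bool" where
  "eff_prog_solution P xs =
     is_arg_max (\<lambda>(x, s). \<Sum>i\<in>UNIV. s $ i)
       (\<lambda>(x, s). crit P x - s = crit P xs \<and> x \<in> int_feas P \<and> (\<forall>i. s $ i \<ge> 0))"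

record 'n memory =
  psi_opt :: ereal
  x_opt   :: "(real ^ 'n::finite) option"
  pot_eff :: "(real ^ 'n::finite) set"

definition update_best ::
  "('n::finite, 'm::finite, 'k::finite) problem \<Rightarrow> real ^ 'n \<Rightarrow> 'n memory \<Rightarrow> 'n memory" where
  "update_best P x M =
     (if ereal (psi P x) > psi_opt M then M\<lparr>psi_opt := ereal (psi P x), x_opt := Some x\<rparr> else M)"

definition update_pot_eff ::
  "('n::finite, 'm::finite, 'k::finite) problem \<Rightarrow> real ^ 'n \<Rightarrow> 'n memory \<Rightarrow> 'n memory" where
  "update_pot_eff P x M =
     (let S = insert x (pot_eff M)
      in M\<lparr>pot_eff := {u \<in> S. \<not> (\<exists>v\<in>S. dominates (crit P v) (crit P u))}\<rparr>)"

text \<open>The cut of type II of a second branch is added when that branch is opened, that is, after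
  the first branch has been completely explored, with the value of \<open>psi_opt\<close> reached by then.  It
  is void as long as that value is \<open>-\<infinity>\<close>.\<close>

datatype 'n node = Node "'n constr list" | Second_Branch "'n constr list"

fun open_node ::
  "('n::finite, 'm::finite, 'k::finite) problem \<Rightarrow> 'n memory \<Rightarrow> 'n node \<Rightarrow> 'n constr list" where
  "open_node P M (Node cs) = cs"
| "open_node P M (Second_Branch cs) =
     (if psi_opt M = -\<infinity> then cs else cs @ [cut_II P (real_of_ereal (psi_opt M))])"

text \<open>A configuration records the step to be executed next.  The solvers of the subproblems are not
  modelled: each subproblem may return any of its optimal (for the node programs: optimal basic)
  solutions, and the branching coordinate is arbitrary.  The list of nodes is the stack of the
  depth-first search; explicit node indices are not needed.  In \<open>Step3_1\<close>, \<open>None\<close> reports infeasibility, and \<open>Some (x, N)\<close> an optimal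
  basic solution \<open>x\<close> with nonbasic index set \<open>N\<close>.\<close>

datatype 'n config =
    Step0
  | Step1
  | Step2 "'n node list" "'n memory"
  | Step3_1 "'n constr list" "((real ^ 'n) \<times> ('n + nat) set) option" "'n node list" "'n memory"
  | Step3_2 "'n constr list" "real ^ 'n" "('n + nat) set" "'n node list" "'n memory"
  | Step3_3 "'n constr list" "real ^ 'n" "('n + nat) set" "'n node list" "'n memory"
  | Step4 "'n constr list" "real ^ 'n" "'n node list" "'n memory"
  | Step5 "'n constr list" "real ^ 'n" "('n + nat) set" "'n node list" "'n memory"
  | Return "(real ^ 'n) option" ereal

inductive step ::
  "('n::finite, 'm::finite, 'k::finite) problem \<Rightarrow> 'n config \<Rightarrow> 'n config \<Rightarrow> bool"
  for P :: "('n, 'm, 'k) problem" where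
  step0_stop:
    "is_arg_max (psi P) (\<lambda>x. x \<in> feas P) x \<Longrightarrow> x \<in> efficient_set P
     \<Longrightarrow> step P Step0 (Return (Some x) (ereal (psi P x)))"
| step0_go:
    "is_arg_max (psi P) (\<lambda>x. x \<in> feas P) x \<Longrightarrow> x \<notin> efficient_set P
     \<Longrightarrow> step P Step0 Step1"
| step1:
    "step P Step1 (Step2 [Node []] \<lparr>psi_opt = -\<infinity>, x_opt = None, pot_eff = {}\<rparr>)"
| step2_end:
    "step P (Step2 [] M) (Return (x_opt M) (psi_opt M))"
| step2_infeasible:
    "cs = open_node P M nd \<Longrightarrow> node_set P cs = {}
     \<Longrightarrow> step P (Step2 (nd # T) M) (Step3_1 cs None T M)"
| step2_solved:
    "cs = open_node P M nd \<Longrightarrow> optimal_basic P cs x N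
     \<Longrightarrow> step P (Step2 (nd # T) M) (Step3_1 cs (Some (x, N)) T M)"
| step3_1_infeasible:
    "step P (Step3_1 cs None T M) (Step2 T M)"
| step3_1_fathom:
    "psi_opt M \<ge> ereal (psi P x)
     \<Longrightarrow> step P (Step3_1 cs (Some (x, N)) T M) (Step2 T M)"
| step3_1_go:
    "\<not> psi_opt M \<ge> ereal (psi P x)
     \<Longrightarrow> step P (Step3_1 cs (Some (x, N)) T M) (Step3_2 cs x N T M)"
| step3_2_integer:
    "integral_point x
     \<Longrightarrow> step P (Step3_2 cs x N T M) (Step3_3 cs x N T (update_pot_eff P x M))"
| step3_2_fractional:
    "\<not> integral_point x
     \<Longrightarrow> step P (Step3_2 cs x N T M) (Step4 cs x T M)"
| step3_3_dominated:
    "x \<notin> pot_eff M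
     \<Longrightarrow> step P (Step3_3 cs x N T M) (Step5 cs x N T M)"
| step3_3_efficient:
    "x \<in> pot_eff M \<Longrightarrow> eff_prog_solution P x (y, s) \<Longrightarrow> (\<Sum>i\<in>UNIV. s $ i) = 0
     \<Longrightarrow> step P (Step3_3 cs x N T M) (Step2 T (update_best P x M))"
| step3_3_inefficient:
    "x \<in> pot_eff M \<Longrightarrow> eff_prog_solution P x (y, s) \<Longrightarrow> (\<Sum>i\<in>UNIV. s $ i) \<noteq> 0
     \<Longrightarrow> step P (Step3_3 cs x N T M) (Step5 cs x N T (update_pot_eff P y (update_best P y M)))"
| step4:
    "x $ j \<notin> \<int>
     \<Longrightarrow> step P (Step4 cs x T M)
          (Step2 (Node (cs @ [(- axis j 1, - real_of_int \<lfloor>x $ j\<rfloor>)])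
                  # Second_Branch (cs @ [(axis j 1, real_of_int (\<lfloor>x $ j\<rfloor> + 1))])
                  # T) M)"
| step5_fathom:
    "is_Delta P cs N \<Delta>
     \<Longrightarrow> \<Delta> = {} \<or> (\<exists>u\<in>pot_eff M. dominates (crit P u) (ideal_point P (node_set P cs)))
     \<Longrightarrow> step P (Step5 cs x N T M) (Step2 T M)"
| step5_cut:
    "is_Delta P cs N \<Delta>
     \<Longrightarrow> \<not> (\<Delta> = {} \<or> (\<exists>u\<in>pot_eff M. dominates (crit P u) (ideal_point P (node_set P cs))))
     \<Longrightarrow> step P (Step5 cs x N T M) (Step2 (Node (cs @ [cut_I cs \<Delta>]) # T) M)"

end

theory Submission
  imports Defs
begin

text \<open>
  Two statements have to be combined: the search cannot run forever, and a configuration in which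
  it cannot continue is a \<open>Return\<close> with the right answer.

  \<^emph>\<open>Correctness\<close> is an invariant of the configurations, \<open>config_inv\<close>: the incumbent, if there is
  one, is an efficient point, and every efficient point that improves on it lies in an open node.
  The only delicate rule is the cut of type I.  Written in the tableau of an integer optimal basic
  solution \<open>x\<close>, the difference of the \<open>i\<close>-th criteria at \<open>y\<close> and \<open>x\<close> is
  \<open>\<Sum>j\<in>N. \<gamma> i j * y\<^sub>j\<close> divided by a positive number, so a point of the node at which all variables
  of \<open>\<Delta>\<close> vanish is either \<open>x\<close> or dominated by \<open>x\<close> (\<open>dominated_if_Delta_eq_0\<close>).  To pass from
  "not all zero" to "the sum is at least 1" for integer points \<open>y\<close>, the variables in \<open>\<Delta>\<close> have to take
  integer values there.  Slack variables of cuts of type II need not do so.  But at a point that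
  is strictly better than the incumbent these slacks are strictly positive, hence basic, hence not
  in \<open>\<Delta>\<close> (\<open>cut_II_slack_pos\<close>); all other constraints have integer coefficients.  So the cut removes
  only inefficient points (\<open>efficient_satisfies_cut_I\<close>).

  \<^emph>\<open>Termination\<close> uses a size of nodes (\<open>node_size\<close>): the number of integer points of the node plus
  the number of pairs \<open>(j, k)\<close> such that some point of the node has its \<open>j\<close>-th coordinate strictly
  between \<open>k\<close> and \<open>k + 1\<close>.  Both numbers are finite by compactness.  A cut of type I removes the
  integer point \<open>x\<close>, and branching on a fractional \<open>x\<^sub>j\<close> removes the pair \<open>(j, \<lfloor>x\<^sub>j\<rfloor>)\<close>
  from both children.
  Weighting a node of size \<open>n\<close> by \<open>3 ^ n\<close> makes two children together lighter than their parent,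
  so the total weight of the stack decreases (\<open>potential_step\<close>).

  \<^emph>\<open>Progress\<close> requires that every subproblem can be solved.  The essential point is that a linear
  fractional program over a nonempty node attains its maximum at a basic solution
  (\<open>optimal_basic_exists\<close>).
\<close>

section \<open>Linear algebra of the standard form\<close>

lemma var_val_Inl: "var_val cs x (Inl j) = x $ j"
  by (simp add: var_val_def var_fun_def inner_axis')

lemma finite_std_vars [simp]: "finite (std_vars cs)"
  by (simp add: std_vars_def)

lemma node_set_iff:
  "x \<in> node_set P cs \<longleftrightarrow>
     mat_A P *v x = vec_b P \<and> (\<forall>v\<in>std_vars cs. 0 \<le> var_val cs x v)"
proof -
  have "(\<forall>(a, h)\<in>set cs. h \<le> a \<bullet> x) \<longleftrightarrow> (\<forall>r<length cs. 0 \<le> var_val cs x (Inr r))"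
    by (force simp: in_set_conv_nth var_val_def var_fun_def case_prod_beta)
  moreover have "(\<forall>j. 0 \<le> x $ j) \<longleftrightarrow> (\<forall>j. 0 \<le> var_val cs x (Inl j))"
    by (simp add: var_val_Inl)
  ultimately show ?thesis
    unfolding node_set_def feas_def std_vars_def by auto
qed

lemma node_setD: "x \<in> node_set P cs \<Longrightarrow> x \<in> feas P"
  by (simp add: node_set_def)

lemma difference_in_kernel:
  assumes "mat_A P *v x = vec_b P" "mat_A P *v y = vec_b P"
  shows "(\<Sum>v\<in>std_vars cs. (var_val cs x v - var_val cs y v) * std_col P cs v \<rho>) = 0"
proof -
  have "(\<Sum>v\<in>std_vars cs. std_col P cs v \<rho> * var_val cs x v)
      = (\<Sum>v\<in>std_vars cs. std_col P cs v \<rho> * var_val cs y v)"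
  proof (cases \<rho>)
    case (Inl i)
    then show ?thesis using assms by (simp add: std_form_original_row)
  next
    case (Inr r)
    show ?thesis
    proof (cases "r < length cs")
      case True
      then show ?thesis using Inr by (simp add: std_form_added_row)
    next
      case False
      then have "std_col P cs v \<rho> = 0" for v
        using Inr by (simp add: std_col_def split: sum.split)
      then show ?thesis by simp
    qed
  qed
  then show ?thesis
    by (simp add: algebra_simps sum_subtractf)
qed

text \<open>The rows of the added constraints force the slack entries of a kernel vector to be the
  changes of the slack variables, so its original entries alone describe a direction in the
  original space.\<close>

lemma kernel_direction:
  fixes P :: "('n::finite, 'm::finite, 'k::finite) problem"
  assumes ker: "\<And>\<rho>. (\<Sum>v\<in>std_vars cs. w v * std_col P cs v \<rho>) = 0"
  obtains d where "mat_A P *v d = 0"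
    and "\<And>v x \<theta>. v \<in> std_vars cs \<Longrightarrow>
           var_val cs (x + \<theta> *\<^sub>R d) v = var_val cs x v + \<theta> * w v"
proof
  define d :: "real ^ 'n" where "d = (\<chi> j. w (Inl j))"
  have split: "(\<Sum>v\<in>std_vars cs. f v) = (\<Sum>j\<in>UNIV. f (Inl j)) + (\<Sum>r<length cs. f (Inr r))"
    for f :: "'n + nat \<Rightarrow> real"
    unfolding std_vars_def by (subst sum.union_disjoint) (auto simp: sum.reindex inj_on_def)
  have "(mat_A P *v d) $ i = 0" for i
    using ker[of "Inl i"]
    by (simp add: split std_col_def matrix_vector_mult_def d_def mult.commute)
  then show "mat_A P *v d = 0" by (simp add: vec_eq_iff)
  have slack: "fst (cs ! r) \<bullet> d = w (Inr r)" if "r < length cs" for r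
    using ker[of "Inr r"] that
    by (simp add: split std_col_def d_def inner_vec_def mult.commute if_distrib[where f = "\<lambda>u. _ * u"]
        sum.If_cases cong: if_cong)
  have dir: "fst (var_fun cs v) \<bullet> d = w v" if "v \<in> std_vars cs" for v
    using that slack by (auto simp: std_vars_def var_fun_def inner_axis' d_def)
  show "var_val cs (x + \<theta> *\<^sub>R d) v = var_val cs x v + \<theta> * w v" if "v \<in> std_vars cs" for v x \<theta>
    using dir[OF that] by (simp add: var_val_def inner_add_right)
qed

lemma extend_to_basis:
  fixes P :: "('n::finite, 'm::finite, 'k::finite) problem"
  assumes "B0 \<subseteq> std_vars cs"
    and "\<forall>w. (\<forall>\<rho>. (\<Sum>v\<in>B0. w v * std_col P cs v \<rho>) = 0) \<longrightarrow> (\<forall>v\<in>B0. w v = 0)"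
  obtains B where "B0 \<subseteq> B" "is_basis P cs B"
proof -
  define indep where "indep B \<longleftrightarrow> B \<subseteq> std_vars cs \<and>
      (\<forall>w. (\<forall>\<rho>. (\<Sum>v\<in>B. w v * std_col P cs v \<rho>) = 0) \<longrightarrow> (\<forall>v\<in>B. w v = 0))" for B
  have "finite {B. indep B}"
    by (rule finite_subset[of _ "Pow (std_vars cs)"]) (auto simp: indep_def)
  moreover have "B0 \<in> {B. indep B}"
    using assms by (simp add: indep_def)
  ultimately obtain B where B: "indep B" "B0 \<subseteq> B" and max: "\<And>B'. indep B' \<Longrightarrow> B \<subseteq> B' \<Longrightarrow> B' = B"
    using finite_has_maximal2[of "{B. indep B}" B0] by auto
  have fin: "finite B"
    using B(1) finite_subset[OF _ finite_std_vars] by (auto simp: indep_def)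
  have "\<exists>u. \<forall>\<rho>. std_col P cs j \<rho> = (\<Sum>v\<in>B. u v * std_col P cs v \<rho>)"
    if j: "j \<in> std_vars cs" for j
  proof (cases "j \<in> B")
    case True
    then have "std_col P cs j \<rho> = (\<Sum>v\<in>B. (if v = j then 1 else 0) * std_col P cs v \<rho>)" for \<rho>
      using fin by (simp add: if_distrib[where f = "\<lambda>u. u * _"] cong: if_cong)
    then show ?thesis by (intro exI[of _ "\<lambda>v. if v = j then 1 else 0"] allI)
  next
    case False
    \<comment> \<open>By maximality of \<open>B\<close>, column \<open>j\<close> depends on the columns of \<open>B\<close>; solve the relation for
      it.\<close>
    then have "\<not> indep (insert j B)"
      using max[of "insert j B"] by blast
    then obtain w where w: "\<And>\<rho>. (\<Sum>v\<in>insert j B. w v * std_col P cs v \<rho>) = 0"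
      and nz: "\<exists>v\<in>insert j B. w v \<noteq> 0"
      using B(1) j unfolding indep_def by auto
    have eq: "w j * std_col P cs j \<rho> + (\<Sum>v\<in>B. w v * std_col P cs v \<rho>) = 0" for \<rho>
      using w[of \<rho>] False fin by simp
    have wj: "w j \<noteq> 0"
    proof
      assume "w j = 0"
      then have "\<forall>v\<in>B. w v = 0"
        using eq B(1) by (simp add: indep_def)
      then show False using nz \<open>w j = 0\<close> by auto
    qed
    have "std_col P cs j \<rho> = (\<Sum>v\<in>B. (- w v / w j) * std_col P cs v \<rho>)" for \<rho>
    proof -
      have "std_col P cs j \<rho> = - (\<Sum>v\<in>B. w v * std_col P cs v \<rho>) / w j"
        using eq[of \<rho>] wj by (simp add: field_simps)
      also have "\<dots> = (\<Sum>v\<in>B. (- w v / w j) * std_col P cs v \<rho>)"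
        by (simp add: sum_divide_distrib sum_negf)
      finally show ?thesis .
    qed
    then show ?thesis by (intro exI[of _ "\<lambda>v. - w v / w j"] allI)
  qed
  then have "is_basis P cs B"
    using B(1) unfolding indep_def is_basis_def by blast
  with B(2) that show ?thesis by blast
qed

text \<open>The variables of two solutions of the equality system differ by an element of the kernel
  of the standard-form matrix. Replacing the nonbasic columns by their expansions in the basis
  turns this into a relation between basic columns only, whose coefficients must therefore
  vanish.\<close>

lemma tableau:
  fixes P :: "('n::finite, 'm::finite, 'k::finite) problem"
  assumes N: "N \<subseteq> std_vars cs" and basis: "is_basis P cs (std_vars cs - N)"
    and xs: "mat_A P *v xs = vec_b P" "\<forall>j\<in>N. var_val cs xs j = 0"
  obtains t where "\<And>x v. mat_A P *v x = vec_b P \<Longrightarrow> v \<in> std_vars cs \<Longrightarrow>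
      var_val cs x v = var_val cs xs v + (\<Sum>j\<in>N. t v j * var_val cs x j)"
proof -
  let ?B = "std_vars cs - N"
  have finN: "finite N" using N finite_subset finite_std_vars by blast
  from basis have indep: "\<And>w. \<forall>\<rho>. (\<Sum>v\<in>?B. w v * std_col P cs v \<rho>) = 0 \<Longrightarrow> \<forall>v\<in>?B. w v = 0"
    and "\<forall>j\<in>std_vars cs. \<exists>w. \<forall>\<rho>. std_col P cs j \<rho> = (\<Sum>v\<in>?B. w v * std_col P cs v \<rho>)"
    unfolding is_basis_def by blast+
  then obtain u where u: "\<And>j \<rho>. j \<in> std_vars cs \<Longrightarrow>
      std_col P cs j \<rho> = (\<Sum>v\<in>?B. u j v * std_col P cs v \<rho>)"
    by metis
  define t where "t v j = (if v \<in> N then if j = v then 1 else 0 else - u j v)" for v j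
  have "var_val cs x v = var_val cs xs v + (\<Sum>j\<in>N. t v j * var_val cs x j)"
    if x: "mat_A P *v x = vec_b P" and v: "v \<in> std_vars cs" for x v
  proof (cases "v \<in> N")
    case True
    then show ?thesis
      using xs(2) finN by (simp add: t_def if_distrib[where f = "\<lambda>u. u * _"] cong: if_cong)
  next
    case False
    let ?y = "\<lambda>v. var_val cs x v - var_val cs xs v"
    have "(\<Sum>v\<in>?B. (?y v + (\<Sum>j\<in>N. var_val cs x j * u j v)) * std_col P cs v \<rho>) = 0" for \<rho>
    proof -
      have "(\<Sum>v\<in>?B. (\<Sum>j\<in>N. var_val cs x j * u j v) * std_col P cs v \<rho>)
          = (\<Sum>j\<in>N. var_val cs x j * (\<Sum>v\<in>?B. u j v * std_col P cs v \<rho>))"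
        unfolding sum_distrib_right sum_distrib_left
        by (subst sum.swap) (simp add: mult.assoc)
      also have "\<dots> = (\<Sum>j\<in>N. ?y j * std_col P cs j \<rho>)"
        using N xs(2) u by (intro sum.cong) auto
      finally have "(\<Sum>v\<in>?B. (?y v + (\<Sum>j\<in>N. var_val cs x j * u j v)) * std_col P cs v \<rho>)
          = (\<Sum>v\<in>?B. ?y v * std_col P cs v \<rho>) + (\<Sum>j\<in>N. ?y j * std_col P cs j \<rho>)"
        by (simp add: distrib_right sum.distrib)
      also have "\<dots> = (\<Sum>v\<in>std_vars cs. ?y v * std_col P cs v \<rho>)"
        using sum.subset_diff[OF N, of "\<lambda>v. ?y v * std_col P cs v \<rho>"] by simp
      also have "\<dots> = 0" by (rule difference_in_kernel[OF x xs(1)])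
      finally show ?thesis .
    qed
    then have "\<forall>v\<in>?B. ?y v + (\<Sum>j\<in>N. var_val cs x j * u j v) = 0"
      by (intro indep allI)
    then have "?y v + (\<Sum>j\<in>N. var_val cs x j * u j v) = 0"
      using v False by blast
    then show ?thesis
      using False by (simp add: t_def sum_negf mult.commute)
  qed
  then show ?thesis by (rule that)
qed

lemma eq_if_nonbasic_eq_0:
  assumes "N \<subseteq> std_vars cs" "is_basis P cs (std_vars cs - N)"
    and "mat_A P *v xs = vec_b P" "\<forall>j\<in>N. var_val cs xs j = 0"
    and "mat_A P *v x = vec_b P" "\<forall>j\<in>N. var_val cs x j = 0"
  shows "x = xs"
proof -
  obtain t where t: "\<And>x v. mat_A P *v x = vec_b P \<Longrightarrow> v \<in> std_vars cs \<Longrightarrow>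
      var_val cs x v = var_val cs xs v + (\<Sum>j\<in>N. t v j * var_val cs x j)"
    using tableau[OF assms(1-4)] by blast
  have "x $ k = xs $ k" for k
    using t[OF assms(5), of "Inl k"] assms(6) by (simp add: std_vars_def var_val_Inl)
  then show ?thesis by (simp add: vec_eq_iff)
qed

text \<open>The original variables are themselves variables of the tableau, so an affine function of
  them is obtained by substitution.\<close>

lemma reduced_form_exists:
  assumes "N \<subseteq> std_vars cs" "is_basis P cs (std_vars cs - N)"
    and "mat_A P *v xs = vec_b P" "\<forall>j\<in>N. var_val cs xs j = 0"
  shows "\<exists>ab a0b. reduced_form P cs N a a0 ab a0b"
proof -
  obtain t where t: "\<And>x v. mat_A P *v x = vec_b P \<Longrightarrow> v \<in> std_vars cs \<Longrightarrow>
      var_val cs x v = var_val cs xs v + (\<Sum>j\<in>N. t v j * var_val cs x j)"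
    using tableau[OF assms] by blast
  have "a \<bullet> x + a0 = (\<Sum>j\<in>N. (\<Sum>k\<in>UNIV. a $ k * t (Inl k) j) * var_val cs x j) + (a \<bullet> xs + a0)"
    if x: "mat_A P *v x = vec_b P" for x
  proof -
    have "x $ k = xs $ k + (\<Sum>j\<in>N. t (Inl k) j * var_val cs x j)" for k
      using t[OF x, of "Inl k"] by (simp add: std_vars_def var_val_Inl)
    then have "a \<bullet> x = (\<Sum>k\<in>UNIV. a $ k * (xs $ k + (\<Sum>j\<in>N. t (Inl k) j * var_val cs x j)))"
      by (simp add: inner_vec_def)
    also have "\<dots> = a \<bullet> xs + (\<Sum>k\<in>UNIV. \<Sum>j\<in>N. a $ k * t (Inl k) j * var_val cs x j)"
      by (simp add: inner_vec_def distrib_left sum.distrib sum_distrib_left mult.assoc)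
    also have "(\<Sum>k\<in>UNIV. \<Sum>j\<in>N. a $ k * t (Inl k) j * var_val cs x j)
        = (\<Sum>j\<in>N. (\<Sum>k\<in>UNIV. a $ k * t (Inl k) j) * var_val cs x j)"
      by (subst sum.swap) (simp add: sum_distrib_right)
    finally show ?thesis by simp
  qed
  then show ?thesis
    unfolding reduced_form_def
    by (intro exI[of _ "\<lambda>j. \<Sum>k\<in>UNIV. a $ k * t (Inl k) j"] exI[of _ "a \<bullet> xs + a0"]) blast
qed

section \<open>Optimal basic solutions and domination in the tableau\<close>

locale fractional_program =
  fixes P :: "('n::finite, 'm::finite, 'k::finite) problem"
  assumes feas_nonempty: "feas P \<noteq> {}"
    and compact_feas: "compact (feas P)"
    and crit_denominator_pos: "\<And>x i. x \<in> feas P \<Longrightarrow> vec_q P $ i \<bullet> x + coef_be P $ i > 0"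
    and psi_denominator_pos: "\<And>x. x \<in> feas P \<Longrightarrow> vec_d P \<bullet> x + coef_mu P > 0"
begin

lemma compact_node_set: "compact (node_set P cs)"
proof -
  have "node_set P cs = feas P \<inter> (\<Inter>c\<in>set cs. {x. fst c \<bullet> x \<ge> snd c})"
    by (auto simp: node_set_def case_prod_beta)
  moreover have "closed (\<Inter>c\<in>set cs. {x. fst c \<bullet> x \<ge> snd c})"
    by (intro closed_INT ballI closed_halfspace_ge)
  ultimately show ?thesis
    using compact_feas by (simp add: compact_Int_closed)
qed

lemma psi_maximum_exists:
  assumes "compact S" "S \<noteq> {}" "S \<subseteq> feas P"
  shows "\<exists>x. is_arg_max (psi P) (\<lambda>x. x \<in> S) x"
proof -
  have "continuous_on S (psi P)"
    unfolding psi_def using assms(3) psi_denominator_pos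
    by (intro continuous_intros) (metis less_irrefl subsetD)
  then show ?thesis
    using continuous_attains_sup[OF assms(1,2), of "psi P"] by (auto simp: is_arg_max_linorder)
qed

text \<open>Among the maximizers take one with the fewest nonzero variables. If the columns of its
  support were dependent, it could be moved in both directions along a line. A linear fractional
  function is monotone along a segment on which its denominator is positive, so it does not
  decrease in the direction opposite to one in which it does not increase. Hence a move in the
  direction in which some variable decreases preserves optimality, and it can be continued until
  the first variable of the support vanishes. This contradicts the choice. An independent
  support extends to a basis.\<close>

lemma optimal_basic_exists:
  assumes "node_set P cs \<noteq> {}"
  shows "\<exists>x N. optimal_basic P cs x N"
proof -
  let ?opt = "is_arg_max (psi P) (\<lambda>x. x \<in> node_set P cs)"
  define supp where "supp x = {v \<in> std_vars cs. var_val cs x v \<noteq> 0}" for x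
  have "node_set P cs \<subseteq> feas P" by (auto dest: node_setD)
  then obtain x0 where "?opt x0"
    using psi_maximum_exists[OF compact_node_set assms] by blast
  then obtain x where x: "?opt x" and least: "\<And>y. ?opt y \<Longrightarrow> card (supp x) \<le> card (supp y)"
    using ex_has_least_nat[of ?opt x0 "\<lambda>x. card (supp x)"] by auto
  have xS: "x \<in> node_set P cs" and max: "\<And>y. y \<in> node_set P cs \<Longrightarrow> psi P y \<le> psi P x"
    using x by (auto simp: is_arg_max_linorder)
  have x_nonneg: "0 \<le> var_val cs x v" if "v \<in> std_vars cs" for v
    using xS that by (simp add: node_set_iff)
  have supp_sub: "supp x \<subseteq> std_vars cs" and fin: "finite (supp x)"
    by (auto simp: supp_def)
  have x_pos: "0 < var_val cs x v" if "v \<in> supp x" for v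
    using that x_nonneg[of v] by (auto simp: supp_def)
  have "\<forall>v\<in>supp x. w0 v = 0"
    if w0: "\<forall>\<rho>. (\<Sum>v\<in>supp x. w0 v * std_col P cs v \<rho>) = 0" for w0
  proof (rule ccontr)
    assume "\<not> (\<forall>v\<in>supp x. w0 v = 0)"
    then obtain v0 where v0: "v0 \<in> supp x" "w0 v0 \<noteq> 0" by blast
    \<comment> \<open>The sign is chosen such that at least one variable decreases along the direction.\<close>
    define w where "w v = (if v \<in> supp x then - sgn (w0 v0) * w0 v else 0)" for v
    have w_neg: "w v0 < 0" using v0 by (simp add: w_def sgn_if)
    have w_out: "w v = 0" if "v \<notin> supp x" for v using that by (simp add: w_def)
    have "(\<Sum>v\<in>std_vars cs. w v * std_col P cs v \<rho>) = 0" for \<rho>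
    proof -
      have "(\<Sum>v\<in>std_vars cs. w v * std_col P cs v \<rho>) = (\<Sum>v\<in>supp x. w v * std_col P cs v \<rho>)"
        using supp_sub w_out by (intro sum.mono_neutral_right) auto
      also have "\<dots> = - sgn (w0 v0) * (\<Sum>v\<in>supp x. w0 v * std_col P cs v \<rho>)"
        by (simp add: w_def sum_distrib_left mult.assoc sum_negf)
      finally show ?thesis using w0 by simp
    qed
    then obtain dir where dir: "mat_A P *v dir = 0"
      and move: "\<And>v y \<theta>. v \<in> std_vars cs \<Longrightarrow>
           var_val cs (y + \<theta> *\<^sub>R dir) v = var_val cs y v + \<theta> * w v"
      using kernel_direction[where w = w and cs = cs and P = P] by blast
    have feasible: "x + \<theta> *\<^sub>R dir \<in> node_set P cs"
      if nonneg: "\<And>v. v \<in> supp x \<Longrightarrow> 0 \<le> var_val cs x v + \<theta> * w v" for \<theta>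
    proof -
      have "0 \<le> var_val cs x v + \<theta> * w v" if "v \<in> std_vars cs" for v
        using that nonneg[of v] w_out[of v] x_nonneg[of v] by (cases "v \<in> supp x") auto
      then show ?thesis
        using xS dir move
        by (simp add: node_set_iff matrix_vector_right_distrib matrix_vector_mult_scaleR)
    qed
    \<comment> \<open>A step backwards that is short enough for all variables of the support to remain
      nonnegative.\<close>
    define \<epsilon> where "\<epsilon> = Min ((\<lambda>v. var_val cs x v / (\<bar>w v\<bar> + 1)) ` supp x)"
    have "\<epsilon> > 0"
      unfolding \<epsilon>_def using fin v0 x_pos by (subst Min_gr_iff) (auto intro!: divide_pos_pos)
    have "x + (- \<epsilon>) *\<^sub>R dir \<in> node_set P cs"
    proof (rule feasible)
      fix v assume v: "v \<in> supp x"
      then have "\<epsilon> \<le> var_val cs x v / (\<bar>w v\<bar> + 1)"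
        unfolding \<epsilon>_def using fin by simp
      then have "\<epsilon> * (\<bar>w v\<bar> + 1) \<le> var_val cs x v"
        by (simp add: pos_le_divide_eq)
      moreover have "\<epsilon> * w v \<le> \<epsilon> * (\<bar>w v\<bar> + 1)"
        using \<open>\<epsilon> > 0\<close> by (intro mult_left_mono) auto
      ultimately show "0 \<le> var_val cs x v + (- \<epsilon>) * w v" by simp
    qed
    define R where "R = {v \<in> supp x. w v < 0}"
    \<comment> \<open>The ratio test: the longest forward step that keeps all variables nonnegative.\<close>
    define \<theta> where "\<theta> = Min ((\<lambda>v. var_val cs x v / - w v) ` R)"
    have R: "finite R" "R \<noteq> {}" using fin v0 w_neg by (auto simp: R_def)
    then have "\<theta> \<in> (\<lambda>v. var_val cs x v / - w v) ` R"
      unfolding \<theta>_def by (intro Min_in) auto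
    then obtain v1 where v1: "v1 \<in> R" "\<theta> = var_val cs x v1 / - w v1" by blast
    have "\<theta> > 0" using v1 x_pos[of v1] by (simp add: R_def divide_pos_neg)
    define y where "y = x + \<theta> *\<^sub>R dir"
    have yS: "y \<in> node_set P cs"
      unfolding y_def
    proof (rule feasible)
      fix v assume v: "v \<in> supp x"
      show "0 \<le> var_val cs x v + \<theta> * w v"
      proof (cases "w v < 0")
        case True
        then have "\<theta> \<le> var_val cs x v / - w v"
          unfolding \<theta>_def using R v by (simp add: R_def)
        then have "\<theta> * - w v \<le> var_val cs x v"
          using True by (simp only: pos_le_divide_eq neg_0_less_iff_less)
        then show ?thesis by simp
      next
        case False
        then show ?thesis using \<open>\<theta> > 0\<close> x_pos[OF v] by simp
      qed
    qed
    have "psi P x \<le> psi P y"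
    proof -
      let ?r = "psi P x"
      have pos: "vec_d P \<bullet> u + coef_mu P > 0" if "u \<in> node_set P cs" for u
        using that by (intro psi_denominator_pos node_setD)
      have x_eq: "vec_c P \<bullet> x + coef_la P = ?r * (vec_d P \<bullet> x + coef_mu P)"
        using pos[OF xS] by (simp add: psi_def)
      \<comment> \<open>Multiplied by the denominators, optimality against the backward point fixes the sign of
        the slope, and the same slope governs the forward point.\<close>
      have "psi P (x + (- \<epsilon>) *\<^sub>R dir) \<le> ?r" by (rule max) fact
      then have "vec_c P \<bullet> (x + (- \<epsilon>) *\<^sub>R dir) + coef_la P
          \<le> ?r * (vec_d P \<bullet> (x + (- \<epsilon>) *\<^sub>R dir) + coef_mu P)"
        using pos[OF \<open>x + (- \<epsilon>) *\<^sub>R dir \<in> node_set P cs\<close>]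
        by (subst (asm) psi_def) (simp only: pos_divide_le_eq)
      then have "\<epsilon> * (?r * (vec_d P \<bullet> dir)) \<le> \<epsilon> * (vec_c P \<bullet> dir)"
        using x_eq by (simp add: inner_add_right inner_diff_right algebra_simps)
      then have "?r * (vec_d P \<bullet> dir) \<le> vec_c P \<bullet> dir"
        using \<open>\<epsilon> > 0\<close> by simp
      then have "\<theta> * (?r * (vec_d P \<bullet> dir)) \<le> \<theta> * (vec_c P \<bullet> dir)"
        using \<open>\<theta> > 0\<close> by simp
      then have "?r * (vec_d P \<bullet> y + coef_mu P) \<le> vec_c P \<bullet> y + coef_la P"
        using x_eq by (simp add: y_def inner_add_right algebra_simps)
      then show ?thesis
        using pos[OF yS] by (subst (2) psi_def) (simp only: pos_le_divide_eq)
    qed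
    then have "?opt y"
      using yS max by (auto simp: is_arg_max_linorder intro: order_trans)
    have "supp y \<subset> supp x"
    proof
      show "supp y \<subseteq> supp x"
      proof
        fix v assume "v \<in> supp y"
        then show "v \<in> supp x"
          using w_out[of v] move[of v x \<theta>] by (cases "v \<in> supp x") (auto simp: supp_def y_def)
      qed
      have "v1 \<in> supp x" "w v1 < 0" using v1 by (auto simp: R_def)
      moreover from this have "v1 \<notin> supp y"
        using move[of v1 x \<theta>] v1(2) by (simp add: supp_def y_def)
      ultimately show "supp y \<noteq> supp x" by blast
    qed
    then have "card (supp y) < card (supp x)" using fin by (rule psubset_card_mono[rotated])
    then show False using least[OF \<open>?opt y\<close>] by simp
  qed
  then obtain B where B: "supp x \<subseteq> B" "is_basis P cs B"
    using extend_to_basis[OF supp_sub] by blast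
  then have "std_vars cs - (std_vars cs - B) = B"
    by (auto simp: is_basis_def)
  then have "optimal_basic P cs x (std_vars cs - B)"
    using B x by (auto simp: optimal_basic_def supp_def)
  then show ?thesis by blast
qed

lemma optimal_basicD:
  assumes "optimal_basic P cs x N"
  shows "x \<in> node_set P cs" "mat_A P *v x = vec_b P" "N \<subseteq> std_vars cs"
    "is_basis P cs (std_vars cs - N)" "\<forall>j\<in>N. var_val cs x j = 0"
    "\<And>y. y \<in> node_set P cs \<Longrightarrow> psi P y \<le> psi P x"
  using assms by (auto simp: optimal_basic_def is_arg_max_linorder node_set_iff)

lemma Delta_exists:
  assumes "optimal_basic P cs x N"
  shows "\<exists>\<Delta>. is_Delta P cs N \<Delta>"
proof -
  note ob = optimal_basicD[OF assms]
  have "\<forall>i. \<exists>ab a0b. reduced_form P cs N (vec_p P $ i) (coef_al P $ i) ab a0b"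
    "\<forall>i. \<exists>ab a0b. reduced_form P cs N (vec_q P $ i) (coef_be P $ i) ab a0b"
    using reduced_form_exists[OF ob(3,4,2,5)] by blast+
  then obtain pb alb qb beb where
    "\<forall>i. reduced_form P cs N (vec_p P $ i) (coef_al P $ i) (pb i) (alb i)"
    "\<forall>i. reduced_form P cs N (vec_q P $ i) (coef_be P $ i) (qb i) (beb i)"
    by metis
  then show ?thesis
    unfolding is_Delta_def
    by (intro exI[of _ pb] exI[of _ alb] exI[of _ qb] exI[of _ beb]
        exI[of _ "\<lambda>i j. beb i * pb i j - alb i * qb i j"] exI conjI allI refl) auto
qed

text \<open>At a point where the variables of \<open>\<Delta>\<close> vanish, only variables \<open>j\<close> with all \<open>\<gamma> i j \<le> 0\<close> and
  some \<open>\<gamma> i j < 0\<close> contribute, so no criterion exceeds its value at \<open>x\<close>. A point other than \<open>x\<close>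
  has a nonzero nonbasic variable, which makes one criterion strictly smaller.\<close>

lemma dominated_if_Delta_eq_0:
  assumes opt: "optimal_basic P cs x N" and Delta: "is_Delta P cs N \<Delta>"
    and y: "y \<in> node_set P cs" "\<forall>j\<in>\<Delta>. var_val cs y j = 0" "y \<noteq> x"
  shows "dominates (crit P x) (crit P y)"
proof -
  note ob = optimal_basicD[OF opt]
  from Delta obtain pb alb qb beb \<gamma> where
    p: "\<And>i. reduced_form P cs N (vec_p P $ i) (coef_al P $ i) (pb i) (alb i)" and
    q: "\<And>i. reduced_form P cs N (vec_q P $ i) (coef_be P $ i) (qb i) (beb i)" and
    \<gamma>: "\<And>i j. \<gamma> i j = beb i * pb i j - alb i * qb i j" and
    \<Delta>: "\<Delta> = {j \<in> N. \<exists>i::'k. \<gamma> i j > 0} \<union> {j \<in> N. \<forall>i::'k. \<gamma> i j = 0}"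
    unfolding is_Delta_def by blast
  have yA: "mat_A P *v y = vec_b P" and ypos: "\<And>v. v \<in> std_vars cs \<Longrightarrow> 0 \<le> var_val cs y v"
    using y(1) by (auto simp: node_set_iff)
  let ?y = "var_val cs y"
  let ?q = "\<lambda>i. (\<Sum>j\<in>N. qb i j * ?y j) + beb i"
  have terms: "\<gamma> i j * ?y j \<le> 0" if "j \<in> N" for i j
  proof (cases "j \<in> \<Delta>")
    case True
    then show ?thesis using y(2) by simp
  next
    case False
    then have "\<gamma> i j \<le> 0" using that \<Delta> by (auto simp: not_less)
    then show ?thesis using ypos[of j] that ob(3) by (auto intro: mult_nonpos_nonneg)
  qed
  have px: "vec_p P $ i \<bullet> x + coef_al P $ i = alb i"
    and qx: "vec_q P $ i \<bullet> x + coef_be P $ i = beb i" for i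
    using p[of i] q[of i] ob(2,5) by (auto simp: reduced_form_def)
  have py: "vec_p P $ i \<bullet> y + coef_al P $ i = (\<Sum>j\<in>N. pb i j * ?y j) + alb i"
    and qy: "vec_q P $ i \<bullet> y + coef_be P $ i = ?q i" for i
    using p[of i] q[of i] yA by (auto simp: reduced_form_def)
  have beb_pos: "beb i > 0" and q_pos: "?q i > 0" for i
    using crit_denominator_pos[OF node_setD[OF ob(1)], of i]
      crit_denominator_pos[OF node_setD[OF y(1)], of i] qx[of i] qy[of i] by auto
  have diff: "crit P y $ i - crit P x $ i = (\<Sum>j\<in>N. \<gamma> i j * ?y j) / (beb i * ?q i)" for i
  proof -
    have "crit P y $ i - crit P x $ i = ((\<Sum>j\<in>N. pb i j * ?y j) + alb i) / ?q i - alb i / beb i"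
      by (simp add: crit_def px qx py qy)
    also have "\<dots> = (beb i * (\<Sum>j\<in>N. pb i j * ?y j) - alb i * (\<Sum>j\<in>N. qb i j * ?y j))
        / (beb i * ?q i)"
      using beb_pos[of i] q_pos[of i] by (simp add: diff_frac_eq algebra_simps)
    also have "beb i * (\<Sum>j\<in>N. pb i j * ?y j) - alb i * (\<Sum>j\<in>N. qb i j * ?y j)
        = (\<Sum>j\<in>N. \<gamma> i j * ?y j)"
      by (simp add: \<gamma> sum_distrib_left sum_subtractf left_diff_distrib mult.assoc)
    finally show ?thesis .
  qed
  have "crit P y $ i \<le> crit P x $ i" for i
  proof -
    have "(\<Sum>j\<in>N. \<gamma> i j * ?y j) / (beb i * ?q i) \<le> 0"
      using beb_pos[of i] q_pos[of i] terms
      by (intro divide_nonpos_pos sum_nonpos) auto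
    then show ?thesis using diff[of i] by simp
  qed
  moreover have "\<exists>i. crit P y $ i < crit P x $ i"
  proof -
    obtain j where j: "j \<in> N" "?y j \<noteq> 0"
      using eq_if_nonbasic_eq_0[OF ob(3,4,2,5) yA] y(3) by blast
    then have "j \<notin> \<Delta>" using y(2) by blast
    then obtain i where "\<gamma> i j < 0"
      using j \<Delta> by (auto simp: not_less) (metis less_le)
    moreover have "0 < ?y j"
      using j ypos[of j] ob(3) by force
    ultimately have "\<gamma> i j * ?y j < 0"
      by (rule mult_neg_pos)
    moreover have "finite N" using ob(3) finite_subset finite_std_vars by blast
    ultimately have "(\<Sum>j\<in>N. \<gamma> i j * ?y j) < 0"
      using sum_strict_mono_ex1[of N "\<lambda>j. \<gamma> i j * ?y j" "\<lambda>_. 0"] terms j by auto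
    then have "(\<Sum>j\<in>N. \<gamma> i j * ?y j) / (beb i * ?q i) < 0"
      using beb_pos[of i] q_pos[of i] by (intro divide_neg_pos) auto
    then show ?thesis using diff[of i] by (intro exI[of _ i]) simp
  qed
  ultimately show ?thesis by (simp add: dominates_def)
qed

end

section \<open>Integrality of constraints\<close>

definition integral_constr :: "'n::finite constr \<Rightarrow> bool" where
  "integral_constr c \<longleftrightarrow> (\<forall>j. fst c $ j \<in> \<int>) \<and> snd c \<in> \<int>"

lemma var_val_Ints:
  assumes "integral_constr (var_fun cs v)" "integral_point y"
  shows "var_val cs y v \<in> \<int>"
  using assms unfolding var_val_def integral_constr_def integral_point_def inner_vec_def
  by (auto intro!: Ints_diff Ints_sum Ints_mult)

lemma integral_constr_cut_I:
  assumes "\<And>j. j \<in> \<Delta> \<Longrightarrow> integral_constr (var_fun cs j)"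
  shows "integral_constr (cut_I cs \<Delta>)"
  using assms unfolding integral_constr_def cut_I_def
  by (auto intro!: Ints_add Ints_sum simp: sum_component)

lemma integral_constr_var_fun_Inl: "integral_constr (var_fun cs (Inl j))"
  by (auto simp: integral_constr_def var_fun_def axis_def)

section \<open>The size of a node\<close>

lemma finite_integral_points_bounded:
  fixes S :: "(real ^ 'n::finite) set"
  assumes "bounded S"
  shows "finite {x \<in> S. integral_point x}"
proof -
  obtain B where B: "\<And>x. x \<in> S \<Longrightarrow> norm x \<le> B"
    using assms by (auto simp: bounded_iff)
  let ?F = "real_of_int ` {- \<lceil>B\<rceil>..\<lceil>B\<rceil>}"
  have "{x \<in> S. integral_point x} \<subseteq> vec_lambda ` (UNIV \<rightarrow>\<^sub>E ?F)"
  proof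
    fix x assume "x \<in> {x \<in> S. integral_point x}"
    then have x: "x \<in> S" "\<And>j. x $ j \<in> \<int>" by (auto simp: integral_point_def)
    have "x $ j \<in> ?F" for j
    proof -
      obtain k where k: "x $ j = of_int k" using x(2) by (auto simp: Ints_def)
      have "\<bar>x $ j\<bar> \<le> B" using component_le_norm_cart[of x j] B[OF x(1)] by linarith
      then have "k \<in> {- \<lceil>B\<rceil>..\<lceil>B\<rceil>}" using k by (auto; linarith)
      then show ?thesis using k by blast
    qed
    then have "vec_nth x \<in> UNIV \<rightarrow>\<^sub>E ?F" by (auto simp: PiE_UNIV_domain)
    then show "x \<in> vec_lambda ` (UNIV \<rightarrow>\<^sub>E ?F)"
      by (metis image_eqI vec_nth_inverse)
  qed
  moreover have "finite (vec_lambda ` (UNIV \<rightarrow>\<^sub>E ?F) :: (real ^ 'n) set)"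
    by (intro finite_imageI finite_PiE) auto
  ultimately show ?thesis by (rule finite_subset)
qed

text \<open>A child of a branching may contain all integer points of its parent, so their number
  cannot measure the progress made. The open unit intervals met by the coordinates can:
  branching on \<open>x\<^sub>j\<close> empties the interval that contains it.\<close>

definition unit_cells :: "(real ^ 'n::finite) set \<Rightarrow> ('n \<times> int) set" where
  "unit_cells S = {(j, k). \<exists>x\<in>S. of_int k < x $ j \<and> x $ j < of_int k + 1}"

lemma finite_unit_cells:
  fixes S :: "(real ^ 'n::finite) set"
  assumes "bounded S"
  shows "finite (unit_cells S)"
proof -
  obtain B where B: "\<And>x. x \<in> S \<Longrightarrow> norm x \<le> B"
    using assms by (auto simp: bounded_iff)
  have "unit_cells S \<subseteq> UNIV \<times> {- \<lceil>B\<rceil> - 1..\<lceil>B\<rceil>}"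
  proof
    fix p assume "p \<in> unit_cells S"
    then obtain j k x where p: "p = (j, k)" "x \<in> S" "of_int k < x $ j" "x $ j < of_int k + 1"
      by (auto simp: unit_cells_def)
    have "\<bar>x $ j\<bar> \<le> B" using component_le_norm_cart[of x j] B[OF p(2)] by linarith
    then have "k \<in> {- \<lceil>B\<rceil> - 1..\<lceil>B\<rceil>}" using p(3,4) by (auto; linarith)
    then show "p \<in> UNIV \<times> {- \<lceil>B\<rceil> - 1..\<lceil>B\<rceil>}" using p(1) by simp
  qed
  then show ?thesis by (rule finite_subset) simp
qed

text \<open>Counting points and intervals of the node set, rather than data of its constraints, makes
  the size monotone under inclusion, so that cuts of type II need no separate treatment.\<close>

definition node_size ::
  "('n::finite, 'm::finite, 'k::finite) problem \<Rightarrow> 'n constr list \<Rightarrow> nat" where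
  "node_size P cs = card {y \<in> node_set P cs. integral_point y} + card (unit_cells (node_set P cs))"

fun node_constrs :: "'n::finite node \<Rightarrow> 'n constr list" where
  "node_constrs (Node cs) = cs"
| "node_constrs (Second_Branch cs) = cs"

lemma node_set_append_subset: "node_set P (cs @ cs') \<subseteq> node_set P cs"
  by (auto simp: node_set_def)

lemma open_node_subset: "node_set P (open_node P M nd) \<subseteq> node_set P (node_constrs nd)"
  by (cases nd) (auto simp: node_set_def)

context fractional_program
begin

lemma bounded_node_set: "bounded (node_set P cs)"
  by (intro compact_imp_bounded compact_node_set)

lemma node_size_mono:
  assumes "node_set P cs' \<subseteq> node_set P cs"
  shows "node_size P cs' \<le> node_size P cs"
  unfolding node_size_def using assms
  by (intro add_mono card_mono finite_integral_points_bounded finite_unit_cells bounded_node_set)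
    (auto simp: unit_cells_def)

lemma node_size_less_integral:
  assumes "node_set P cs' \<subseteq> node_set P cs" "x \<in> node_set P cs - node_set P cs'" "integral_point x"
  shows "node_size P cs' < node_size P cs"
  unfolding node_size_def using assms
  by (intro add_less_le_mono psubset_card_mono card_mono finite_integral_points_bounded
      finite_unit_cells bounded_node_set) (auto simp: unit_cells_def)

lemma node_size_less_fractional:
  assumes "node_set P cs' \<subseteq> node_set P cs" "x \<in> node_set P cs" "x $ j \<notin> \<int>"
    and "\<And>y. y \<in> node_set P cs' \<Longrightarrow> y $ j \<le> of_int \<lfloor>x $ j\<rfloor> \<or> of_int \<lfloor>x $ j\<rfloor> + 1 \<le> y $ j"
  shows "node_size P cs' < node_size P cs"
proof -
  have "of_int \<lfloor>x $ j\<rfloor> \<noteq> x $ j"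
    using assms(3) by (metis Ints_of_int)
  then have "of_int \<lfloor>x $ j\<rfloor> < x $ j"
    using of_int_floor_le[of "x $ j"] by linarith
  then have "(j, \<lfloor>x $ j\<rfloor>) \<in> unit_cells (node_set P cs)"
    using assms(2) by (auto simp: unit_cells_def intro!: bexI[of _ x])
  moreover have "(j, \<lfloor>x $ j\<rfloor>) \<notin> unit_cells (node_set P cs')"
    using assms(4) by (force simp: unit_cells_def)
  moreover have "unit_cells (node_set P cs') \<subseteq> unit_cells (node_set P cs)"
    using assms(1) by (auto simp: unit_cells_def)
  ultimately have "unit_cells (node_set P cs') \<subset> unit_cells (node_set P cs)"
    by blast
  then show ?thesis
    unfolding node_size_def using assms(1)
    by (intro add_le_less_mono psubset_card_mono card_mono finite_integral_points_bounded
      finite_unit_cells bounded_node_set) auto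
qed

lemma finite_int_feas: "finite (int_feas P)"
  using finite_integral_points_bounded[OF compact_imp_bounded[OF compact_feas]]
  by (simp add: int_feas_def)

section \<open>Ideal point and efficiency program\<close>

lemma crit_le_ideal_point:
  assumes "y \<in> node_set P cs"
  shows "crit P y $ i \<le> ideal_point P (node_set P cs) $ i"
proof -
  have "vec_q P $ i \<bullet> x + coef_be P $ i \<noteq> 0" if "x \<in> node_set P cs" for x
    using crit_denominator_pos[OF node_setD[OF that], of i] by simp
  then have "continuous_on (node_set P cs) (\<lambda>x. crit P x $ i)"
    by (auto simp: crit_def intro!: continuous_intros)
  then have "bdd_above ((\<lambda>x. crit P x $ i) ` node_set P cs)"
    by (intro bounded_imp_bdd_above compact_imp_bounded compact_continuous_image compact_node_set)
  then show ?thesis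
    using cSUP_upper[OF assms, of "\<lambda>x. crit P x $ i"] by (simp add: ideal_point_def)
qed

text \<open>The slack vector \<open>s\<close> is determined by the point, which leaves a maximization over the
  integer points whose criteria are no worse than those of \<open>x\<close>.\<close>

lemma eff_prog_solution_iff:
  "eff_prog_solution P x (y, s) \<longleftrightarrow>
     y \<in> int_feas P \<and> s = crit P y - crit P x \<and> (\<forall>i. 0 \<le> s $ i) \<and>
     (\<forall>u\<in>int_feas P. (\<forall>i. crit P x $ i \<le> crit P u $ i) \<longrightarrow>
        (\<Sum>i\<in>UNIV. crit P u $ i - crit P x $ i) \<le> (\<Sum>i\<in>UNIV. s $ i))"
proof -
  have "crit P u - t = crit P x \<longleftrightarrow> t = crit P u - crit P x" for u t
    by (auto simp: algebra_simps)
  then show ?thesis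
    unfolding eff_prog_solution_def is_arg_max_linorder by auto
qed

lemma eff_prog_solution_exists:
  assumes "x \<in> int_feas P"
  shows "\<exists>y s. eff_prog_solution P x (y, s)"
proof -
  let ?U = "{u \<in> int_feas P. \<forall>i. crit P x $ i \<le> crit P u $ i}"
  define f where "f u = (\<Sum>i\<in>UNIV. crit P u $ i - crit P x $ i)" for u
  have U: "finite ?U" "?U \<noteq> {}" using finite_int_feas assms by auto
  then have "Max (f ` ?U) \<in> f ` ?U" by (intro Max_in) auto
  then obtain y where y: "y \<in> ?U" "Max (f ` ?U) = f y" by (rule imageE)
  have "f u \<le> f y" if "u \<in> ?U" for u
    unfolding y(2)[symmetric] using U that by (intro Max_ge) auto
  then have "eff_prog_solution P x (y, crit P y - crit P x)"
    using y(1) by (simp add: eff_prog_solution_iff f_def)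
  then show ?thesis by blast
qed

lemma eff_prog_zero_efficient:
  assumes "x \<in> int_feas P" "eff_prog_solution P x (y, s)" "(\<Sum>i\<in>UNIV. s $ i) = 0"
  shows "x \<in> efficient_set P"
proof -
  have "\<not> dominates (crit P u) (crit P x)" if "u \<in> int_feas P" for u
  proof
    assume "dominates (crit P u) (crit P x)"
    then have le: "\<And>i. crit P x $ i \<le> crit P u $ i" and "\<exists>i. crit P x $ i < crit P u $ i"
      by (auto simp: dominates_def)
    then obtain i where "crit P x $ i < crit P u $ i" by blast
    with le have "0 < (\<Sum>i\<in>UNIV. crit P u $ i - crit P x $ i)"
      by (intro sum_pos2[of UNIV i]) auto
    moreover have "(\<Sum>i\<in>UNIV. crit P u $ i - crit P x $ i) \<le> (\<Sum>i\<in>UNIV. s $ i)"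
      using assms(2) that le unfolding eff_prog_solution_iff by blast
    ultimately show False using assms(3) by simp
  qed
  then show ?thesis using assms(1) by (auto simp: efficient_set_def)
qed

text \<open>A point dominating \<open>y\<close> would also be no worse than \<open>x\<close> and would have a larger sum of
  criteria.\<close>

lemma eff_prog_nonzero:
  assumes "eff_prog_solution P x (y, s)" "(\<Sum>i\<in>UNIV. s $ i) \<noteq> 0"
  shows "x \<notin> efficient_set P" "y \<in> efficient_set P"
proof -
  from assms(1) have y: "y \<in> int_feas P" "s = crit P y - crit P x" "\<forall>i. 0 \<le> s $ i"
    and max: "\<And>u. u \<in> int_feas P \<Longrightarrow> \<forall>i. crit P x $ i \<le> crit P u $ i \<Longrightarrow>
        (\<Sum>i\<in>UNIV. crit P u $ i - crit P x $ i) \<le> (\<Sum>i\<in>UNIV. s $ i)"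
    by (auto simp: eff_prog_solution_iff)
  obtain i where "s $ i \<noteq> 0" using assms(2) by (metis sum.neutral)
  then have "dominates (crit P y) (crit P x)"
    using y(2,3) unfolding dominates_def by (auto simp: less_le intro!: exI[of _ i])
  then show "x \<notin> efficient_set P" using y(1) by (auto simp: efficient_set_def)
  have "\<not> dominates (crit P u) (crit P y)" if u: "u \<in> int_feas P" for u
  proof
    assume "dominates (crit P u) (crit P y)"
    then have le: "\<And>i. crit P y $ i \<le> crit P u $ i" and "\<exists>i. crit P y $ i < crit P u $ i"
      by (auto simp: dominates_def)
    then have "(\<Sum>i\<in>UNIV. crit P y $ i - crit P x $ i) < (\<Sum>i\<in>UNIV. crit P u $ i - crit P x $ i)"
      by (intro sum_strict_mono_ex1) auto
    moreover have "\<forall>i. crit P x $ i \<le> crit P u $ i"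
      using le y(2,3) by (auto intro: order_trans)
    ultimately show False using max[OF u] y(2) by simp
  qed
  then show "y \<in> efficient_set P" using y(1) by (auto simp: efficient_set_def)
qed

end

section \<open>The invariant of the search\<close>

lemma psi_opt_update_best:
  "psi_opt (update_best P x M) = max (psi_opt M) (ereal (psi P x))"
  by (auto simp: update_best_def)

lemma psi_opt_update_pot_eff:
  "psi_opt (update_pot_eff P x M) = psi_opt M"
  by (auto simp: update_pot_eff_def)

context fractional_program
begin

definition correct_output :: "(real ^ 'n) option \<Rightarrow> ereal \<Rightarrow> bool" where
  "correct_output xo v \<longleftrightarrow>
     (if efficient_set P = {} then xo = None \<and> v = -\<infinity>
      else \<exists>x. xo = Some x \<and> v = ereal (psi P x) \<and>
               is_arg_max (psi P) (\<lambda>x. x \<in> efficient_set P) x)"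

definition memory_inv :: "'n memory \<Rightarrow> bool" where
  "memory_inv M \<longleftrightarrow> pot_eff M \<subseteq> int_feas P \<and>
     (psi_opt M = -\<infinity> \<and> x_opt M = None \<or>
      (\<exists>x\<in>efficient_set P. x_opt M = Some x \<and> psi_opt M = ereal (psi P x)))"

text \<open>The bound on \<open>t\<close> records that a cut of type II was made with an incumbent value that can
  only have increased since.\<close>

definition constrs_inv :: "'n memory \<Rightarrow> 'n constr list \<Rightarrow> bool" where
  "constrs_inv M cs \<longleftrightarrow>
     (\<forall>c\<in>set cs. integral_constr c \<or> (\<exists>t. ereal t \<le> psi_opt M \<and> c = cut_II P t))"

definition covered :: "'n memory \<Rightarrow> 'n constr list set \<Rightarrow> real ^ 'n \<Rightarrow> bool" where
  "covered M Cs y \<longleftrightarrow> ereal (psi P y) \<le> psi_opt M \<or> (\<exists>cs\<in>Cs. y \<in> node_set P cs)"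

definition search_inv :: "'n memory \<Rightarrow> 'n constr list set \<Rightarrow> bool" where
  "search_inv M Cs \<longleftrightarrow>
     memory_inv M \<and> (\<forall>cs\<in>Cs. constrs_inv M cs) \<and> (\<forall>y\<in>efficient_set P. covered M Cs y)"

lemma search_inv_memory:
  assumes "search_inv M Cs" "memory_inv M'" "psi_opt M \<le> psi_opt M'"
  shows "search_inv M' Cs"
  using assms unfolding search_inv_def constrs_inv_def covered_def
  by (meson order_trans)

text \<open>All steps that modify the stack replace the current node by none, one or two new ones.\<close>

lemma search_inv_replace:
  assumes "search_inv M (insert cs Cs)"
    and "\<And>cs'. cs' \<in> Cs' \<Longrightarrow> constrs_inv M cs'"
    and "\<And>y. y \<in> efficient_set P \<Longrightarrow> y \<in> node_set P cs \<Longrightarrow> covered M Cs' y"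
  shows "search_inv M (Cs' \<union> Cs)"
  using assms unfolding search_inv_def covered_def by blast

lemma search_inv_drop:
  assumes "search_inv M (insert cs Cs)"
    and "\<And>y. y \<in> efficient_set P \<Longrightarrow> y \<in> node_set P cs \<Longrightarrow> ereal (psi P y) \<le> psi_opt M"
  shows "search_inv M Cs"
  using search_inv_replace[OF assms(1), of "{}"] assms(2) by (simp add: covered_def)

lemma memory_inv_update_pot_eff:
  assumes "memory_inv M" "x \<in> int_feas P"
  shows "memory_inv (update_pot_eff P x M)"
  using assms by (auto simp: memory_inv_def update_pot_eff_def)

lemma memory_inv_update_best:
  assumes "memory_inv M" "x \<in> efficient_set P"
  shows "memory_inv (update_best P x M)"
  using assms by (auto simp: memory_inv_def update_best_def)

lemma constrs_inv_append:
  "constrs_inv M (cs @ [c]) \<longleftrightarrow>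
     constrs_inv M cs \<and> (integral_constr c \<or> (\<exists>t. ereal t \<le> psi_opt M \<and> c = cut_II P t))"
  by (auto simp: constrs_inv_def)

text \<open>The cut of type II discards only points that are worse than the incumbent.\<close>

lemma search_inv_open_node:
  assumes inv: "search_inv M (insert (node_constrs nd) Cs)"
  shows "search_inv M (insert (open_node P M nd) Cs)"
proof (cases nd)
  case (Node cs)
  then show ?thesis using inv by simp
next
  case (Second_Branch cs)
  show ?thesis
  proof (cases "psi_opt M = -\<infinity>")
    case True
    then show ?thesis using inv Second_Branch by simp
  next
    case False
    then obtain r where r: "psi_opt M = ereal r"
      using inv by (auto simp: search_inv_def memory_inv_def)
    let ?cs = "cs @ [cut_II P r]"
    have "open_node P M nd = ?cs" using Second_Branch r by simp
    moreover have "search_inv M ({?cs} \<union> Cs)"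
    proof (rule search_inv_replace)
      show "search_inv M (insert cs Cs)" using inv Second_Branch by simp
      then have "constrs_inv M cs" by (simp add: search_inv_def)
      then show "constrs_inv M cs'" if "cs' \<in> {?cs}" for cs'
        using that r by (auto simp: constrs_inv_append)
      show "covered M {?cs} y" if "y \<in> node_set P cs" for y
      proof (cases "r \<le> psi P y")
        case True
        have "node_set P ?cs = {x \<in> node_set P cs. r \<le> psi P x}"
          by (rule node_set_cut_II) (rule psi_denominator_pos)
        then show ?thesis using True that unfolding covered_def by blast
      next
        case False
        then show ?thesis using r unfolding covered_def by simp
      qed
    qed
    ultimately show ?thesis by simp
  qed
qed

lemma integral_point_int_feas: "x \<in> node_set P cs \<Longrightarrow> integral_point x \<Longrightarrow> x \<in> int_feas P"
  by (auto simp: int_feas_def dest: node_setD)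

lemma efficient_integral: "y \<in> efficient_set P \<Longrightarrow> integral_point y \<and> y \<in> feas P"
  by (auto simp: efficient_set_def int_feas_def)

lemma not_kept_not_efficient:
  assumes "memory_inv M" "x \<in> int_feas P" "x \<notin> pot_eff (update_pot_eff P x M)"
  shows "x \<notin> efficient_set P"
proof -
  obtain v where "v \<in> insert x (pot_eff M)" "dominates (crit P v) (crit P x)"
    using assms(3) by (auto simp: update_pot_eff_def Let_def)
  then show ?thesis
    using assms(1,2) by (auto simp: memory_inv_def efficient_set_def)
qed

text \<open>A cut of type II with bound \<open>t\<close> is strict at \<open>x\<close> because \<open>\<psi>\<close> exceeds the incumbent value
  there, which is at least \<open>t\<close>.\<close>

lemma cut_II_slack_pos:
  assumes x: "x \<in> node_set P cs" and inv: "constrs_inv M cs" and gt: "psi_opt M < ereal (psi P x)"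
    and r: "r < length cs"
  shows "integral_constr (cs ! r) \<or> 0 < var_val cs x (Inr r)"
proof -
  have "cs ! r \<in> set cs" using r by simp
  then consider "integral_constr (cs ! r)" | t where "ereal t \<le> psi_opt M" "cs ! r = cut_II P t"
    using inv by (auto simp: constrs_inv_def)
  then show ?thesis
  proof cases
    case 2
    have "t < psi P x" using le_less_trans[OF 2(1) gt] by simp
    then have "t * (vec_d P \<bullet> x + coef_mu P) < vec_c P \<bullet> x + coef_la P"
      using psi_denominator_pos[OF node_setD[OF x]] by (simp add: psi_def pos_less_divide_eq)
    then show ?thesis
      using 2(2) by (simp add: var_val_def var_fun_def cut_II_def inner_diff_left algebra_simps)
  qed simp
qed

text \<open>The comparison of \<open>x\<close> with the incumbent may be lost when the efficiency program improves
  the incumbent. This consequence of it does not refer to the incumbent and survives until the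
  cut of type I is made.\<close>

definition slacks_inv :: "'n constr list \<Rightarrow> real ^ 'n \<Rightarrow> bool" where
  "slacks_inv cs x \<longleftrightarrow> (\<forall>r<length cs. integral_constr (cs ! r) \<or> 0 < var_val cs x (Inr r))"

lemma Delta_integral:
  assumes "optimal_basic P cs x N" "slacks_inv cs x" "is_Delta P cs N \<Delta>" "j \<in> \<Delta>"
  shows "integral_constr (var_fun cs j)"
proof -
  note ob = optimal_basicD[OF assms(1)]
  have "j \<in> N" using assms(3,4) by (auto simp: is_Delta_def)
  then have j: "var_val cs x j = 0" "j \<in> std_vars cs" using ob(3,5) by auto
  show ?thesis
  proof (cases j)
    case (Inl i)
    then show ?thesis by (simp add: integral_constr_var_fun_Inl)
  next
    case (Inr r)
    then show ?thesis using assms(2) j by (auto simp: slacks_inv_def std_vars_def var_fun_def)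
  qed
qed

text \<open>An efficient \<open>y\<close> is neither \<open>x\<close> nor dominated by \<open>x\<close>, so some variable in \<open>\<Delta>\<close> is nonzero
  at \<open>y\<close>. Its value is a nonnegative integer, hence at least 1.\<close>

lemma efficient_satisfies_cut_I:
  assumes opt: "optimal_basic P cs x N" and x: "integral_point x" "x \<notin> efficient_set P"
    and slacks: "slacks_inv cs x" and Delta: "is_Delta P cs N \<Delta>"
    and y: "y \<in> efficient_set P" "y \<in> node_set P cs"
  shows "\<Delta> \<noteq> {}" "y \<in> node_set P (cs @ [cut_I cs \<Delta>])"
proof -
  note ob = optimal_basicD[OF opt]
  have \<Delta>N: "\<Delta> \<subseteq> N" using Delta by (auto simp: is_Delta_def)
  then have fin: "finite \<Delta>" using ob(3) finite_subset finite_std_vars by (metis order_trans)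
  have nonneg: "0 \<le> var_val cs y j" if "j \<in> \<Delta>" for j
    using that y(2) \<Delta>N ob(3) by (auto simp: node_set_iff)
  have "\<not> (\<forall>j\<in>\<Delta>. var_val cs y j = 0)"
  proof
    assume "\<forall>j\<in>\<Delta>. var_val cs y j = 0"
    moreover have "y \<noteq> x" using x(2) y(1) by blast
    ultimately have "dominates (crit P x) (crit P y)"
      using dominated_if_Delta_eq_0[OF opt Delta y(2)] by blast
    moreover have "x \<in> int_feas P" using ob(1) x(1) by (rule integral_point_int_feas)
    ultimately show False using y(1) by (auto simp: efficient_set_def)
  qed
  then obtain j where j: "j \<in> \<Delta>" "var_val cs y j \<noteq> 0" by blast
  then show "\<Delta> \<noteq> {}" by blast
  have "var_val cs y j \<in> \<int>"
    using var_val_Ints[OF Delta_integral[OF opt slacks Delta j(1)]] efficient_integral[OF y(1)]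
    by blast
  then have "1 \<le> var_val cs y j"
    using nonneg[OF j(1)] j(2) by (auto simp: Ints_def)
  also have "\<dots> \<le> (\<Sum>j\<in>\<Delta>. var_val cs y j)"
    using fin j(1) nonneg by (intro member_le_sum) auto
  finally show "y \<in> node_set P (cs @ [cut_I cs \<Delta>])"
    using y(2) by (simp add: node_set_cut_I)
qed

text \<open>The ideal point is an upper bound for the criteria of every point of the node, so what
  dominates the former also dominates the latter.\<close>

lemma ideal_dominated_not_efficient:
  assumes "u \<in> int_feas P" "dominates (crit P u) (ideal_point P (node_set P cs))"
    and "y \<in> node_set P cs"
  shows "y \<notin> efficient_set P"
proof -
  have le: "crit P y $ i \<le> ideal_point P (node_set P cs) $ i" for i
    by (rule crit_le_ideal_point) fact
  have "dominates (crit P u) (crit P y)"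
    unfolding dominates_def
  proof
    show "\<forall>i. crit P y $ i \<le> crit P u $ i"
      using assms(2) le by (meson dominates_def order_trans)
    show "\<exists>i. crit P y $ i < crit P u $ i"
      using assms(2) le by (meson dominates_def le_less_trans)
  qed
  then show ?thesis using assms(1) by (auto simp: efficient_set_def)
qed

lemma branch_covers:
  assumes "integral_point y" "y \<in> node_set P cs"
  shows "y \<in> node_set P (cs @ [(- axis j 1, - real_of_int \<lfloor>a\<rfloor>)]) \<or>
         y \<in> node_set P (cs @ [(axis j 1, real_of_int (\<lfloor>a\<rfloor> + 1))])"
proof -
  obtain k where k: "y $ j = of_int k" using assms(1) by (auto simp: integral_point_def Ints_def)
  have "k \<le> \<lfloor>a\<rfloor> \<or> \<lfloor>a\<rfloor> + 1 \<le> k" by linarith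
  then have "y $ j \<le> of_int \<lfloor>a\<rfloor> \<or> of_int (\<lfloor>a\<rfloor> + 1) \<le> y $ j"
    unfolding k of_int_le_iff .
  then show ?thesis
    using assms(2) by (auto simp: node_set_def inner_axis' inner_minus_left)
qed

lemma integral_branch_constrs:
  "integral_constr (- axis j 1, - real_of_int k)" "integral_constr (axis j 1, real_of_int k)"
  by (auto simp: integral_constr_def axis_def)

abbreviation stack_constrs :: "'n node list \<Rightarrow> 'n constr list set" where
  "stack_constrs T \<equiv> node_constrs ` set T"

text \<open>During the treatment of a node its constraints \<open>cs\<close> are no longer on the stack, but the
  node still counts as open.\<close>

fun config_inv :: "'n config \<Rightarrow> bool" where
  "config_inv Step0 \<longleftrightarrow> True"
| "config_inv Step1 \<longleftrightarrow> True"
| "config_inv (Step2 T M) \<longleftrightarrow> search_inv M (stack_constrs T)"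
| "config_inv (Step3_1 cs None T M) \<longleftrightarrow>
     search_inv M (insert cs (stack_constrs T)) \<and> node_set P cs = {}"
| "config_inv (Step3_1 cs (Some (x, N)) T M) \<longleftrightarrow>
     search_inv M (insert cs (stack_constrs T)) \<and> optimal_basic P cs x N"
| "config_inv (Step3_2 cs x N T M) \<longleftrightarrow>
     search_inv M (insert cs (stack_constrs T)) \<and> optimal_basic P cs x N \<and>
     psi_opt M < ereal (psi P x)"
| "config_inv (Step3_3 cs x N T M) \<longleftrightarrow>
     search_inv M (insert cs (stack_constrs T)) \<and> optimal_basic P cs x N \<and>
     integral_point x \<and> slacks_inv cs x \<and> (x \<in> pot_eff M \<or> x \<notin> efficient_set P)"
| "config_inv (Step4 cs x T M) \<longleftrightarrow>
     search_inv M (insert cs (stack_constrs T)) \<and> x \<in> node_set P cs \<and> \<not> integral_point x"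
| "config_inv (Step5 cs x N T M) \<longleftrightarrow>
     search_inv M (insert cs (stack_constrs T)) \<and> optimal_basic P cs x N \<and>
     integral_point x \<and> slacks_inv cs x \<and> x \<notin> efficient_set P"
| "config_inv (Return xo v) \<longleftrightarrow> correct_output xo v"

lemma correct_output_final:
  assumes "search_inv M {}"
  shows "correct_output (x_opt M) (psi_opt M)"
proof -
  have le: "ereal (psi P y) \<le> psi_opt M" if "y \<in> efficient_set P" for y
    using assms that by (auto simp: search_inv_def covered_def)
  have "psi_opt M = -\<infinity> \<and> x_opt M = None \<or>
      (\<exists>x\<in>efficient_set P. x_opt M = Some x \<and> psi_opt M = ereal (psi P x))"
    using assms by (auto simp: search_inv_def memory_inv_def)
  then show ?thesis
    using le by (fastforce simp: correct_output_def is_arg_max_linorder)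
qed

lemma config_inv_step:
  assumes "step P C C'" "config_inv C"
  shows "config_inv C'"
  using assms
proof (cases rule: step.cases)
  case (step0_stop x)
  then show ?thesis
    by (auto simp: correct_output_def is_arg_max_linorder dest: efficient_integral)
next
  case step1
  have "y \<in> node_set P []" if "y \<in> efficient_set P" for y
    using efficient_integral[OF that] by (simp add: node_set_def)
  then show ?thesis
    using step1 by (auto simp: search_inv_def memory_inv_def constrs_inv_def covered_def)
next
  case (step2_end M)
  then show ?thesis using assms(2) correct_output_final by simp
next
  case (step2_infeasible cs M nd T)
  then show ?thesis using assms(2) search_inv_open_node by auto
next
  case (step2_solved cs M nd x N T)
  then show ?thesis using assms(2) search_inv_open_node by auto
next
  case (step3_1_infeasible cs T M)
  then show ?thesis using assms(2) search_inv_drop[of M cs] by auto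
next
  case (step3_1_fathom M x cs N T)
  then have inv: "search_inv M (insert cs (stack_constrs T))" and opt: "optimal_basic P cs x N"
    using assms(2) by auto
  from inv have "search_inv M (stack_constrs T)"
  proof (rule search_inv_drop)
    fix y assume "y \<in> node_set P cs"
    then have "ereal (psi P y) \<le> ereal (psi P x)" using optimal_basicD(6)[OF opt] by simp
    then show "ereal (psi P y) \<le> psi_opt M" using step3_1_fathom(3) by (rule order_trans)
  qed
  then show ?thesis using step3_1_fathom(2) by simp
next
  case (step3_2_integer x cs N T M)
  then have inv: "search_inv M (insert cs (stack_constrs T))" and opt: "optimal_basic P cs x N"
    and gt: "psi_opt M < ereal (psi P x)"
    using assms(2) by auto
  have mem: "memory_inv M" and con: "constrs_inv M cs" using inv by (auto simp: search_inv_def)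
  have x: "x \<in> int_feas P"
    using optimal_basicD(1)[OF opt] step3_2_integer(3) by (rule integral_point_int_feas)
  have "slacks_inv cs x"
    unfolding slacks_inv_def
    using cut_II_slack_pos[OF optimal_basicD(1)[OF opt] con gt] by blast
  moreover have "search_inv (update_pot_eff P x M) (insert cs (stack_constrs T))"
    using inv memory_inv_update_pot_eff[OF mem x]
    by (rule search_inv_memory) (simp add: psi_opt_update_pot_eff)
  ultimately show ?thesis
    using step3_2_integer opt not_kept_not_efficient[OF mem x] by auto
next
  case (step3_2_fractional x cs N T M)
  then show ?thesis using assms(2) optimal_basicD(1) by auto
next
  case (step3_3_efficient x M y s cs N T)
  then have inv: "search_inv M (insert cs (stack_constrs T))" and opt: "optimal_basic P cs x N"
    and int: "integral_point x"
    using assms(2) by auto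
  have eff: "x \<in> efficient_set P"
    using integral_point_int_feas[OF optimal_basicD(1)[OF opt] int] step3_3_efficient(4,5)
    by (rule eff_prog_zero_efficient)
  have "memory_inv (update_best P x M)"
    using inv eff by (simp add: memory_inv_update_best search_inv_def)
  with inv have "search_inv (update_best P x M) (insert cs (stack_constrs T))"
    by (rule search_inv_memory) (simp add: psi_opt_update_best)
  then have "search_inv (update_best P x M) (stack_constrs T)"
    by (rule search_inv_drop)
      (use optimal_basicD(6)[OF opt] in \<open>auto simp: psi_opt_update_best le_max_iff_disj\<close>)
  then show ?thesis using step3_3_efficient(2) by simp
next
  case (step3_3_inefficient x M y s cs N T)
  let ?M = "update_pot_eff P y (update_best P y M)"
  have inv: "search_inv M (insert cs (stack_constrs T))"
    using step3_3_inefficient(1) assms(2) by auto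
  note eff = eff_prog_nonzero[OF step3_3_inefficient(4,5)]
  have "memory_inv ?M"
    using inv eff(2)
    by (auto simp: search_inv_def efficient_set_def
        intro!: memory_inv_update_pot_eff memory_inv_update_best)
  with inv have "search_inv ?M (insert cs (stack_constrs T))"
    by (rule search_inv_memory) (simp add: psi_opt_update_best psi_opt_update_pot_eff)
  then show ?thesis
    using step3_3_inefficient(1,2) assms(2) eff(1) by auto
next
  case (step4 x j cs T M)
  let ?l = "cs @ [(- axis j 1, - real_of_int \<lfloor>x $ j\<rfloor>)]"
  let ?r = "cs @ [(axis j 1, real_of_int (\<lfloor>x $ j\<rfloor> + 1))]"
  have inv: "search_inv M (insert cs (stack_constrs T))"
    using step4(1) assms(2) by auto
  then have "search_inv M ({?l, ?r} \<union> stack_constrs T)"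
  proof (rule search_inv_replace)
    have "constrs_inv M cs" using inv by (simp add: search_inv_def)
    then show "constrs_inv M cs'" if "cs' \<in> {?l, ?r}" for cs'
      using that integral_branch_constrs by (auto simp only: constrs_inv_append insert_iff empty_iff)
    show "covered M {?l, ?r} y" if "y \<in> efficient_set P" "y \<in> node_set P cs" for y
      using branch_covers[of y cs j "x $ j"] efficient_integral[OF that(1)] that(2)
      by (simp add: covered_def)
  qed
  then show ?thesis using step4(2) by simp
next
  case (step5_fathom cs N \<Delta> M x T)
  then have inv: "search_inv M (insert cs (stack_constrs T))" and opt: "optimal_basic P cs x N"
    and x: "integral_point x" "x \<notin> efficient_set P" "slacks_inv cs x"
    using assms(2) by auto
  have "pot_eff M \<subseteq> int_feas P" using inv by (auto simp: search_inv_def memory_inv_def)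
  then have "y \<notin> efficient_set P" if "y \<in> node_set P cs" for y
    using step5_fathom(4) efficient_satisfies_cut_I(1)[OF opt x step5_fathom(3)]
      ideal_dominated_not_efficient[of _ cs y] that by blast
  then have "search_inv M (stack_constrs T)"
    using search_inv_drop[OF inv] by blast
  then show ?thesis using step5_fathom(2) by simp
next
  case (step5_cut cs N \<Delta> M x T)
  then have inv: "search_inv M (insert cs (stack_constrs T))" and opt: "optimal_basic P cs x N"
    and x: "integral_point x" "x \<notin> efficient_set P" "slacks_inv cs x"
    using assms(2) by auto
  have "search_inv M ({cs @ [cut_I cs \<Delta>]} \<union> stack_constrs T)"
    using inv
  proof (rule search_inv_replace)
    have "constrs_inv M cs" using inv by (simp add: search_inv_def)
    moreover have "integral_constr (cut_I cs \<Delta>)"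
      by (intro integral_constr_cut_I Delta_integral[OF opt x(3) step5_cut(3)])
    ultimately show "constrs_inv M cs'" if "cs' \<in> {cs @ [cut_I cs \<Delta>]}" for cs'
      using that by (simp add: constrs_inv_append)
    show "covered M {cs @ [cut_I cs \<Delta>]} y" if "y \<in> efficient_set P" "y \<in> node_set P cs" for y
      using efficient_satisfies_cut_I(2)[OF opt x step5_cut(3) that] by (simp add: covered_def)
  qed
  then show ?thesis using step5_cut(2) by simp
next
  case (step0_go x)
  then show ?thesis by simp
next
  case (step3_1_go M x cs N T)
  then show ?thesis using assms(2) by (simp add: not_le)
next
  case (step3_3_dominated x M cs N T)
  then show ?thesis using assms(2) by simp
qed

section \<open>Termination\<close>

definition stack_weight :: "'n node list \<Rightarrow> nat" where
  "stack_weight T = (\<Sum>nd\<leftarrow>T. 3 ^ node_size P (node_constrs nd))"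

text \<open>The additive constants order the steps within one treatment of a node, from \<open>5\<close> in Step 2
  down to \<open>1\<close> in Steps 4 and 5. The factor \<open>6\<close> lets the loss of one unit of weight pay for the
  return to Step 2.\<close>

fun potential :: "'n config \<Rightarrow> nat" where
  "potential Step0 = 6 * stack_weight [Node []] + 7"
| "potential Step1 = 6 * stack_weight [Node []] + 6"
| "potential (Step2 T M) = 6 * stack_weight T + 5"
| "potential (Step3_1 cs sol T M) = 6 * stack_weight (Node cs # T) + 4"
| "potential (Step3_2 cs x N T M) = 6 * stack_weight (Node cs # T) + 3"
| "potential (Step3_3 cs x N T M) = 6 * stack_weight (Node cs # T) + 2"
| "potential (Step4 cs x T M) = 6 * stack_weight (Node cs # T) + 1"
| "potential (Step5 cs x N T M) = 6 * stack_weight (Node cs # T) + 1"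
| "potential (Return xo v) = 0"

lemma stack_weight_Cons:
  "stack_weight (nd # T) = 3 ^ node_size P (node_constrs nd) + stack_weight T"
  by (simp add: stack_weight_def)

lemma stack_weight_open:
  "stack_weight (Node (open_node P M nd) # T) \<le> stack_weight (nd # T)"
  using node_size_mono[OF open_node_subset, of M nd] by (simp add: stack_weight_Cons)

lemma potential_drop: "6 * stack_weight T + 5 < 6 * stack_weight (nd # T)"
proof -
  have "6 * s + 5 < 6 * (w + s)" if "0 < w" for s w :: nat
    using that by simp
  moreover have "(0::nat) < 3 ^ node_size P (node_constrs nd)" by simp
  ultimately show ?thesis unfolding stack_weight_Cons by blast
qed

lemma cut_I_size_less:
  assumes "optimal_basic P cs x N" "integral_point x" "is_Delta P cs N \<Delta>"
  shows "node_size P (cs @ [cut_I cs \<Delta>]) < node_size P cs"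
proof (rule node_size_less_integral)
  have "\<Delta> \<subseteq> N" using assms(3) by (auto simp: is_Delta_def)
  then have "(\<Sum>j\<in>\<Delta>. var_val cs x j) = 0"
    using optimal_basicD(5)[OF assms(1)] by (intro sum.neutral) blast
  then show "x \<in> node_set P cs - node_set P (cs @ [cut_I cs \<Delta>])"
    using optimal_basicD(1)[OF assms(1)] by (simp add: node_set_cut_I)
qed (use assms in \<open>auto simp: node_set_append_subset\<close>)

text \<open>Both children have size at most \<open>n\<close> if the parent has size \<open>n + 1\<close>, and
  \<open>3 ^ n + 3 ^ n < 3 ^ (n + 1)\<close>. The second child is weighed without the cut of type II, which
  can only make it smaller.\<close>

lemma branch_weight_less:
  assumes "x \<in> node_set P cs" "x $ j \<notin> \<int>"
  shows "stack_weight (Node (cs @ [(- axis j 1, - real_of_int \<lfloor>x $ j\<rfloor>)])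
      # Second_Branch (cs @ [(axis j 1, real_of_int (\<lfloor>x $ j\<rfloor> + 1))]) # T)
    < stack_weight (Node cs # T)"
proof -
  let ?l = "cs @ [(- axis j 1, - real_of_int \<lfloor>x $ j\<rfloor>)]"
  let ?r = "cs @ [(axis j 1, real_of_int (\<lfloor>x $ j\<rfloor> + 1))]"
  have "node_size P ?l < node_size P cs" "node_size P ?r < node_size P cs"
    using assms by (auto intro!: node_size_less_fractional[of _ cs x j] simp: node_set_append_subset)
      (auto simp: node_set_def inner_axis' inner_minus_left)
  then obtain n where n: "node_size P cs = Suc n" "node_size P ?l \<le> n" "node_size P ?r \<le> n"
    by (cases "node_size P cs") auto
  have "(3::nat) ^ node_size P ?l \<le> 3 ^ n" "(3::nat) ^ node_size P ?r \<le> 3 ^ n"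
    using n by (simp_all add: power_increasing)
  moreover have "(0::nat) < 3 ^ n" "(3::nat) ^ node_size P cs = 3 * 3 ^ n" using n by simp_all
  ultimately show ?thesis by (simp only: stack_weight_Cons node_constrs.simps)
qed

lemma potential_step:
  assumes "step P C C'" "config_inv C"
  shows "potential C' < potential C"
  using assms
proof (cases rule: step.cases)
  case (step2_infeasible cs M nd T)
  then show ?thesis using stack_weight_open[of M nd T] by simp
next
  case (step2_solved cs M nd x N T)
  then show ?thesis using stack_weight_open[of M nd T] by simp
next
  case (step3_1_infeasible cs T M)
  then show ?thesis using potential_drop[of T "Node cs"] by simp
next
  case (step3_1_fathom M x cs N T)
  then show ?thesis using potential_drop[of T "Node cs"] by simp
next
  case (step3_3_efficient x M y s cs N T)
  then show ?thesis using potential_drop[of T "Node cs"] by simp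
next
  case (step4 x j cs T M)
  then show ?thesis using branch_weight_less[of x cs j T] assms(2) by simp
next
  case (step5_fathom cs N \<Delta> M x T)
  then show ?thesis using potential_drop[of T "Node cs"] by simp
next
  case (step5_cut cs N \<Delta> M x T)
  then have "node_size P (cs @ [cut_I cs \<Delta>]) < node_size P cs"
    using assms(2) cut_I_size_less by auto
  then have "(3::nat) ^ node_size P (cs @ [cut_I cs \<Delta>]) < 3 ^ node_size P cs" by simp
  moreover have "6 * (v + s) + 5 < 6 * (w + s) + 1" if "v < w" for s v w :: nat
    using that by simp
  ultimately show ?thesis
    unfolding step5_cut(1,2) potential.simps stack_weight_Cons node_constrs.simps by blast
qed simp_all

section \<open>Progress and conclusion\<close>

lemma progress:
  assumes "config_inv C" "\<nexists>C'. step P C C'"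
  shows "\<exists>xo v. C = Return xo v"
proof (cases C)
  case Step0
  obtain x where "is_arg_max (psi P) (\<lambda>x. x \<in> feas P) x"
    using psi_maximum_exists[OF compact_feas feas_nonempty] by blast
  then show ?thesis
    using assms(2) Step0 step0_stop[of P x] step0_go[of P x] by blast
next
  case Step1
  then show ?thesis using assms(2) step1 by blast
next
  case (Step2 T M)
  show ?thesis
  proof (cases T)
    case Nil
    then show ?thesis using assms(2) Step2 step2_end by blast
  next
    case (Cons nd T')
    then show ?thesis
      using assms(2) Step2 step2_infeasible[OF refl] step2_solved[OF refl] optimal_basic_exists
      by metis
  qed
next
  case (Step3_1 cs sol T M)
  show ?thesis
  proof (cases sol)
    case None
    then show ?thesis using assms(2) Step3_1 step3_1_infeasible by blast
  next
    case (Some p)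
    then show ?thesis
      using assms(2) Step3_1 step3_1_fathom step3_1_go by (cases p) blast
  qed
next
  case (Step3_2 cs x N T M)
  then show ?thesis using assms(2) step3_2_integer step3_2_fractional by blast
next
  case (Step3_3 cs x N T M)
  then have "x \<in> int_feas P"
    using assms(1) by (auto intro: integral_point_int_feas optimal_basicD(1))
  then obtain y s where "eff_prog_solution P x (y, s)"
    using eff_prog_solution_exists by blast
  then show ?thesis
    using assms(2) Step3_3 step3_3_dominated step3_3_efficient step3_3_inefficient by metis
next
  case (Step4 cs x T M)
  then obtain j where "x $ j \<notin> \<int>"
    using assms(1) by (auto simp: integral_point_def)
  then show ?thesis using assms(2) Step4 step4 by blast
next
  case (Step5 cs x N T M)
  then obtain \<Delta> where "is_Delta P cs N \<Delta>"
    using assms(1) Delta_exists[of cs x N] by auto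
  then have "\<exists>C'. step P (Step5 cs x N T M) C'"
    using step5_fathom[of P cs N \<Delta> M x T] step5_cut[of P cs N \<Delta> M x T] by blast
  then show ?thesis using assms(2) Step5 by blast
next
  case (Return xo v)
  then show ?thesis by blast
qed

lemma reachable_inv: "(step P)\<^sup>*\<^sup>* Step0 C \<Longrightarrow> config_inv C"
  by (induction rule: rtranclp_induct) (auto intro: config_inv_step)

lemma no_infinite_run:
  assumes "run 0 = Step0" "\<And>t. step P (run t) (run (Suc t))"
  shows False
proof -
  have inv: "config_inv (run t)" for t
    using assms by (induction t) (auto intro: config_inv_step)
  have "potential (run t) + t \<le> potential (run 0)" for t
  proof (induction t)
    case (Suc t)
    then show ?case using potential_step[OF assms(2) inv, of t] by simp
  qed simp
  from this[of "Suc (potential (run 0))"] show False by simp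
qed

end

theorem theorem5:
  fixes P :: "('n::finite, 'm::finite, 'k::finite) problem"
  assumes "feas P \<noteq> {}"
    and "compact (feas P)"
    and "\<And>x i. x \<in> feas P \<Longrightarrow> vec_q P $ i \<bullet> x + coef_be P $ i > 0"
    and "\<And>x. x \<in> feas P \<Longrightarrow> vec_d P \<bullet> x + coef_mu P > 0"
  shows "\<not> (\<exists>run. run 0 = Step0 \<and> (\<forall>t::nat. step P (run t) (run (Suc t)))) \<and>
    (\<forall>C. (step P)\<^sup>*\<^sup>* Step0 C \<and> \<not> (\<exists>C'. step P C C') \<longrightarrow>
       (\<exists>xo v. C = Return xo v \<and>
          (if efficient_set P = {} then xo = None \<and> v = -\<infinity>
           else \<exists>x. xo = Some x \<and> v = ereal (psi P x) \<and>
                    is_arg_max (psi P) (\<lambda>x. x \<in> efficient_set P) x)))"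
proof -
  have "fractional_program P"
    by (rule fractional_program.intro) (fact assms)+
  then interpret fractional_program P .
  have "\<exists>xo v. C = Return xo v \<and> correct_output xo v"
    if "(step P)\<^sup>*\<^sup>* Step0 C" "\<nexists>C'. step P C C'" for C
    using progress[OF reachable_inv[OF that(1)] that(2)] reachable_inv[OF that(1)] by auto
  moreover have "\<not> (\<exists>run. run 0 = Step0 \<and> (\<forall>t::nat. step P (run t) (run (Suc t))))"
    using no_infinite_run by blast
  ultimately show ?thesis
    unfolding correct_output_def by blast
qed

end
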